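(* Let $h:\mathbb{H}\to\mathbb{C}$ be a holomorphic function, where $\mathbb{H}:=\{z\in\mathbb{C}:\operatorname{Re}z>0\}$. Suppose that $h'(\mathbb{H})$ is contained in a closed Euclidean disk $B\subset\mathbb{C}$ with $0\notin B$. Then $h$ admits a $k$-quasiconformal extension to $\overline{\mathbb{C}}$ with a fixed point at $\infty$, where $$k:=\frac{K-1}{K+1},\qquad K:=\max_{w,z\in B}\sqrt{|w/z|}.$$
   Context: $\overline{\mathbb{C}}=\mathbb{C}\cup\{\infty\}$. For $k\in[0,1)$, a $k$-quasiconformal map is an orientation-preserving homeomorphism $F$ with distributional derivatives $\partial_zF,\partial_{\bar z}F\in L^1_{\rm loc}$ satisfying $|\partial_{\bar z}F|\le k|\partial_zF|$ a.e. (in local coordinates on $\overline{\mathbb{C}}$). A function $h$ on $\mathbb{H}$ admits a $k$-quasiconformal extension to $\overline{\mathbb{C}}$ with a fixed point at $\infty$ if there is a $k$-quasiconformal homeomorphism $F:\overline{\mathbb{C}}\to\overline{\mathbb{C}}$ with $F|_{\mathbb{H}}=h$ and $F(\infty)=\infty$. *)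

theory Defs
  imports "HOL-Complex_Analysis.Complex_Analysis"
begin

definition right_half_plane :: "complex set" where
  "right_half_plane = {z. Re z > 0}"

text \<open>The point at infinity is \<open>None\<close>.\<close>

definition riemann_sphere :: "complex option topology" where
  "riemann_sphere = Alexandroff_compactification euclidean"

definition chart_infinity :: "complex \<Rightarrow> complex option" where
  "chart_infinity w = (if w = 0 then None else Some (1 / w))"

text \<open>
  The two standard holomorphic charts are represented by their inverses, that is, by the
  parametrizations \<open>Some\<close> of the complement of infinity and
  \<open>chart_infinity\<close> of the complement of 0.
\<close>

definition sphere_charts :: "(complex \<Rightarrow> complex option) set" where
  "sphere_charts = {Some, chart_infinity}"

definition local_dom ::
  "(complex option \<Rightarrow> complex option) \<Rightarrow> (complex \<Rightarrow> complex option) \<Rightarrow> (complex \<Rightarrow> complex option) \<Rightarrow> complex set" where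
  "local_dom F p q = {z. F (p z) \<in> range q}"

text \<open>The values of \<open>local_rep F p q\<close> are meaningful only on \<open>local_dom F p q\<close>.\<close>

definition local_rep ::
  "(complex option \<Rightarrow> complex option) \<Rightarrow> (complex \<Rightarrow> complex option) \<Rightarrow> (complex \<Rightarrow> complex option) \<Rightarrow> complex \<Rightarrow> complex" where
  "local_rep F p q z = inv q (F (p z))"

text \<open>
  A homeomorphism preserves orientation if its local degree is 1 at every point; in local
  coordinates the local degree at \<open>z\<close> is the winding number about the image of \<open>z\<close> of the
  image of a positively oriented circle around \<open>z\<close>.
\<close>

definition orientation_preserving :: "(complex option \<Rightarrow> complex option) \<Rightarrow> bool" where
  "orientation_preserving F \<longleftrightarrow>
     (\<forall>p\<in>sphere_charts. \<forall>q\<in>sphere_charts. \<forall>z r.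
        r > 0 \<and> cball z r \<subseteq> local_dom F p q \<longrightarrow>
        winding_number (local_rep F p q \<circ> circlepath z r) (local_rep F p q z) = 1)"

definition partial_deriv :: "complex \<Rightarrow> (complex \<Rightarrow> complex) \<Rightarrow> complex \<Rightarrow> complex" where
  "partial_deriv v f z = frechet_derivative f (at z) v"

definition wirtinger :: "(complex \<Rightarrow> complex) \<Rightarrow> complex \<Rightarrow> complex" where
  "wirtinger f z = (partial_deriv 1 f z - \<i> * partial_deriv \<i> f z) / 2"

definition wirtinger_bar :: "(complex \<Rightarrow> complex) \<Rightarrow> complex \<Rightarrow> complex" where
  "wirtinger_bar f z = (partial_deriv 1 f z + \<i> * partial_deriv \<i> f z) / 2"

text \<open>Differentiability is in the real sense: \<open>k_smooth n\<close> is continuous differentiability of order \<open>n\<close> in the two real variables.\<close>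

fun k_smooth :: "nat \<Rightarrow> (complex \<Rightarrow> complex) \<Rightarrow> bool" where
  "k_smooth 0 f \<longleftrightarrow> continuous_on UNIV f"
| "k_smooth (Suc n) f \<longleftrightarrow>
     (\<forall>z. f differentiable (at z)) \<and> k_smooth n (partial_deriv 1 f) \<and> k_smooth n (partial_deriv \<i> f)"

definition test_function :: "complex set \<Rightarrow> (complex \<Rightarrow> complex) \<Rightarrow> bool" where
  "test_function D \<phi> \<longleftrightarrow>
     (\<forall>n. k_smooth n \<phi>) \<and> compact (closure {z. \<phi> z \<noteq> 0}) \<and> closure {z. \<phi> z \<noteq> 0} \<subseteq> D"

definition locally_L1 :: "complex set \<Rightarrow> (complex \<Rightarrow> complex) \<Rightarrow> bool" where
  "locally_L1 D g \<longleftrightarrow> (\<forall>C. compact C \<and> C \<subseteq> D \<longrightarrow> g absolutely_integrable_on C)"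

definition weak_wirtinger :: "complex set \<Rightarrow> (complex \<Rightarrow> complex) \<Rightarrow> (complex \<Rightarrow> complex) \<Rightarrow> bool" where
  "weak_wirtinger D f g \<longleftrightarrow>
     locally_L1 D f \<and> locally_L1 D g \<and>
     (\<forall>\<phi>. test_function D \<phi> \<longrightarrow>
        (LINT z|lebesgue_on D. f z * wirtinger \<phi> z) = - (LINT z|lebesgue_on D. g z * \<phi> z))"

definition weak_wirtinger_bar :: "complex set \<Rightarrow> (complex \<Rightarrow> complex) \<Rightarrow> (complex \<Rightarrow> complex) \<Rightarrow> bool" where
  "weak_wirtinger_bar D f g \<longleftrightarrow>
     locally_L1 D f \<and> locally_L1 D g \<and>
     (\<forall>\<phi>. test_function D \<phi> \<longrightarrow>
        (LINT z|lebesgue_on D. f z * wirtinger_bar \<phi> z) = - (LINT z|lebesgue_on D. g z * \<phi> z))"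

definition quasiconformal :: "real \<Rightarrow> (complex option \<Rightarrow> complex option) \<Rightarrow> bool" where
  "quasiconformal k F \<longleftrightarrow>
     0 \<le> k \<and> k < 1 \<and>
     homeomorphic_map riemann_sphere riemann_sphere F \<and>
     orientation_preserving F \<and>
     (\<forall>p\<in>sphere_charts. \<forall>q\<in>sphere_charts. \<exists>g g'.
        weak_wirtinger (local_dom F p q) (local_rep F p q) g \<and>
        weak_wirtinger_bar (local_dom F p q) (local_rep F p q) g' \<and>
        (AE z in lebesgue_on (local_dom F p q). cmod (g' z) \<le> k * cmod (g z)))"

definition has_qc_extension_fixing_infinity :: "real \<Rightarrow> (complex \<Rightarrow> complex) \<Rightarrow> bool" where
  "has_qc_extension_fixing_infinity k h \<longleftrightarrow>
     (\<exists>F. quasiconformal k F \<and> (\<forall>z\<in>right_half_plane. F (Some z) = Some (h z)) \<and> F None = None)"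

end

theory Submission
  imports Defs
begin

text \<open>
  Write \<open>B = cball c r\<close>, so \<open>r < \<bar>c\<bar>\<close>, and let \<open>d\<close> be the point
  \<open>c * sqrt (1 - (r / \<bar>c\<bar>)\<^sup>2)\<close>. In the half-plane bounded by the line through 0
  orthogonal to \<open>c\<close>, the disk \<open>B\<close> is a hyperbolic disk with hyperbolic centre \<open>d\<close>; this is
  the inequality \<open>\<bar>d - b\<bar> \<le> k * \<bar>d + b\<bar>\<close> for all \<open>b \<in> B\<close>
  (\<open>apollonian_disk_bound\<close>). The function \<open>h - c * id\<close> has derivative bounded by \<open>r\<close>, hence
  is \<open>r\<close>-Lipschitz and extends to the closed half-plane as such; call \<open>H\<close> the resulting
  extension of \<open>h\<close>. The quasiconformal extension is obtained by moving the boundary values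
  at constant velocity in the direction \<open>d\<close>:
  \<open>f (x + i y) = H (i y) + d x\<close> for \<open>x \<le> 0\<close>. (It is the extension that Becker's method gives
  for the chordal Loewner chain \<open>h - t d\<close>.)

  Where \<open>y \<mapsto> H (i y)\<close> is differentiable, its derivative is \<open>i b\<close> with \<open>b \<in> B\<close>, so
  that the derivative of \<open>f\<close> is \<open>w \<mapsto> ((d + b) / 2) w + ((d - b) / 2) (cnj w)\<close> and the
  inequality above is the bound for the dilatation. A Lipschitz function of one real variable
  is differentiable almost everywhere (\<open>negligible_nondifferentiable_lipschitz_curve\<close>, by a
  Vitali covering argument), and for locally Lipschitz functions that are differentiable almost
  everywhere the pointwise derivatives are weak derivatives
  (\<open>weak_wirtinger_of_locally_lipschitz\<close>, by dominated convergence of difference quotients).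

  The global properties follow from one formula (\<open>shear_extension_difference\<close>): every
  increment \<open>f z - f w\<close> with \<open>Re w \<le> Re z\<close> equals \<open>b a + d s\<close>, where \<open>z - w = a + s\<close>,
  \<open>Re a \<ge> 0\<close>, \<open>s \<ge> 0\<close> and \<open>b \<in> B\<close>. Since \<open>b\<close> and \<open>d\<close> lie in a common half-plane,
  \<open>f\<close> is bilipschitz, therefore a homeomorphism of the plane, and its reading in the chart at
  infinity is again locally Lipschitz. As \<open>d \<in> B\<close>, the same formula with the same constants
  holds for \<open>(1 - t) f + t d id\<close>. This isotopy of \<open>f\<close> to an affine map through injective maps
  shows that all local degrees are 1 (\<open>orientation_preserving_of_isotopy\<close>).
\<close>

section \<open>Almost everywhere differentiability on the line\<close>

text \<open>
  The intervals on which \<open>T\<close> has mean slope at most \<open>p\<close> form a Vitali covering of \<open>E\<close>.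
  Choose them inside an open set that is barely larger than \<open>E\<close>; a disjoint subfamily covers
  \<open>E\<close> up to a null set, whose image under the Lipschitz map \<open>T\<close> is null again.
\<close>

lemma emeasure_image_le_of_small_slopes:
  fixes T S :: "real \<Rightarrow> real"
  assumes ST: "\<And>x. S (T x) = x" "\<And>y. T (S y) = y"
    and mono: "strict_mono T" and contS: "continuous_on UNIV S"
    and lip: "L-lipschitz_on UNIV T"
    and E: "E \<in> sets borel" and p: "0 \<le> p"
    and slopes: "\<And>x d. x \<in> E \<Longrightarrow> 0 < d \<Longrightarrow>
       \<exists>a b. a < b \<and> a \<le> x \<and> x \<le> b \<and> b - a < d \<and> T b - T a \<le> p * (b - a)"
  shows "emeasure lborel (T ` E) \<le> ennreal p * emeasure lborel E"
proof -
  have Sb: "S \<in> borel_measurable borel"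
    using contS by (rule borel_measurable_continuous_onI)
  have imT: "T ` X = S -` X" for X
    using ST by (auto simp: image_iff) metis
  have borelT: "T ` X \<in> sets borel" if "X \<in> sets borel" for X
    using measurable_sets[OF Sb that] by (simp add: imT)
  have mono': "T x \<le> T y \<longleftrightarrow> x \<le> y" for x y
    using mono by (simp add: strict_mono_less_eq)
  have imI: "T ` {a..b} = {T a..T b}" for a b
  proof -
    have "y \<in> T ` {a..b}" if "T a \<le> y" "y \<le> T b" for y
      using that ST(2)[of y] mono'[of a "S y"] mono'[of "S y" b] by (metis atLeastAtMost_iff imageI)
    then show ?thesis by (auto simp: mono')
  qed
  have bound: "emeasure lborel (T ` E) \<le> ennreal p * (emeasure lborel E + ennreal e)" if "0 < e" for e
  proof -
    obtain U where U: "open U" "E \<subseteq> U" "emeasure lborel (U - E) < ennreal e"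
      using outer_regular_lborel[OF E \<open>0 < e\<close>] by blast
    define K where "K = {(a, b). a < b \<and> {a..b} \<subseteq> U \<and> T b - T a \<le> p * (b - a)}"
    define mid where "mid = (\<lambda>(a, b). (a + b) / 2 :: real)"
    define rad where "rad = (\<lambda>(a, b). (b - a) / 2 :: real)"
    have cb: "cball (mid i) (rad i) = {fst i..snd i}" for i
      by (cases i) (auto simp: mid_def rad_def cball_eq_atLeastAtMost field_simps)
    have pos: "0 < rad i" if "i \<in> K" for i
      using that by (auto simp: K_def rad_def)
    have fine: "\<exists>i. i \<in> K \<and> x \<in> cball (mid i) (rad i) \<and> rad i < d" if x: "x \<in> E" and d: "0 < d" for x d
    proof -
      obtain \<delta> where \<delta>: "0 < \<delta>" "ball x \<delta> \<subseteq> U"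
        by (meson U(1,2) openE subsetD x)
      obtain a b where ab: "a < b" "a \<le> x" "x \<le> b" "b - a < min d \<delta>" "T b - T a \<le> p * (b - a)"
        using slopes[OF x, of "min d \<delta>"] d \<delta> by auto
      have "{a..b} \<subseteq> ball x \<delta>" using ab by (auto simp: dist_real_def)
      then have "(a, b) \<in> K" using ab \<delta> by (auto simp: K_def)
      moreover have "x \<in> cball (mid (a, b)) (rad (a, b))" using ab by (simp add: cb)
      moreover have "rad (a, b) < d" using ab by (auto simp: rad_def)
      ultimately show ?thesis by blast
    qed
    obtain C where C: "countable C" "C \<subseteq> K"
        "pairwise (\<lambda>i j. disjnt (cball (mid i) (rad i)) (cball (mid j) (rad j))) C"
        "negligible (E - (\<Union>i\<in>C. cball (mid i) (rad i)))"
      using Vitali_covering_theorem_cballs[of K rad E mid] pos fine by blast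
    define V where "V = (\<Union>i\<in>C. {fst i..snd i})"
    have disj: "disjoint_family_on (\<lambda>i. {fst i..snd i}) C"
      using C(3) by (auto simp: pairwise_def disjoint_family_on_def disjnt_def cb)
    then have disjT: "disjoint_family_on (\<lambda>i. T ` {fst i..snd i}) C"
      using strict_mono_imp_inj_on[OF mono]
      by (simp add: disjoint_family_on_def flip: image_Int)
    have V: "V \<in> sets borel"
      using C(1) unfolding V_def by (intro sets.countable_UN') auto
    have VU: "V \<subseteq> U"
      using C(2) unfolding V_def K_def by fastforce
    have null: "emeasure lborel (T ` (E - V)) = 0"
    proof -
      have "negligible (E - V)" using C(4) by (simp add: V_def cb)
      then have "negligible (T ` (E - V))"
      proof (rule negligible_locally_Lipschitz_image[rotated])
        fix x
        have "\<forall>y\<in>(E - V) \<inter> UNIV. norm (T y - T x) \<le> L * norm (y - x)"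
          using lipschitz_onD[OF lip] by (auto simp: dist_norm)
        then show "\<exists>W B. open W \<and> x \<in> W \<and> (\<forall>y\<in>(E - V) \<inter> W. norm (T y - T x) \<le> B * norm (y - x))"
          by (metis UNIV_I open_UNIV)
      qed simp
      then have "T ` (E - V) \<in> null_sets lebesgue" by (simp add: negligible_iff_null_sets)
      then show ?thesis using borelT[of "E - V"] E V by (auto simp: null_sets_completion_iff)
    qed
    have "emeasure lborel (T ` V) = (\<integral>\<^sup>+i. emeasure lborel (T ` {fst i..snd i}) \<partial>count_space C)"
      unfolding V_def image_UN
      by (rule emeasure_UN_countable[OF _ C(1) disjT]) (auto intro!: borelT)
    also have "\<dots> \<le> (\<integral>\<^sup>+i. ennreal p * emeasure lborel {fst i..snd i} \<partial>count_space C)"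
    proof (rule nn_integral_mono)
      fix i assume "i \<in> space (count_space C)"
      then have "fst i < snd i" "T (snd i) - T (fst i) \<le> p * (snd i - fst i)"
        using C(2) by (auto simp: K_def)
      then show "emeasure lborel (T ` {fst i..snd i}) \<le> ennreal p * emeasure lborel {fst i..snd i}"
        using p mono' by (auto simp: imI ennreal_mult[symmetric] intro!: ennreal_leI)
    qed
    also have "\<dots> = ennreal p * emeasure lborel V"
      unfolding V_def
      by (subst emeasure_UN_countable[OF _ C(1) disj]) (auto simp: nn_integral_cmult)
    also have "\<dots> \<le> ennreal p * emeasure lborel U"
      using V VU U by (intro mult_left_mono emeasure_mono) auto
    also have "\<dots> \<le> ennreal p * (emeasure lborel E + ennreal e)"
    proof (rule mult_left_mono)
      have "emeasure lborel U \<le> emeasure lborel E + emeasure lborel (U - E)"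
        using U E emeasure_subadditive[of E lborel "U - E"] by (simp add: Un_absorb1)
      also have "\<dots> \<le> emeasure lborel E + ennreal e"
        using U by (intro add_left_mono) auto
      finally show "emeasure lborel U \<le> emeasure lborel E + ennreal e" .
    qed simp
    finally have TV: "emeasure lborel (T ` V) \<le> ennreal p * (emeasure lborel E + ennreal e)" .
    have "emeasure lborel (T ` E) \<le> emeasure lborel (T ` V \<union> T ` (E - V))"
      using borelT E V by (intro emeasure_mono) auto
    also have "\<dots> \<le> emeasure lborel (T ` V) + emeasure lborel (T ` (E - V))"
      using borelT[of V] borelT[of "E - V"] E V by (intro emeasure_subadditive) auto
    finally show ?thesis using null TV by simp
  qed
  have "((\<lambda>e. ennreal p * (emeasure lborel E + ennreal e)) \<longlongrightarrow>
      ennreal p * (emeasure lborel E + ennreal 0)) (at_right 0)"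
    by (intro tendsto_intros ennreal_tendsto_cmult) auto
  moreover have "eventually (\<lambda>e. emeasure lborel (T ` E) \<le> ennreal p * (emeasure lborel E + ennreal e)) (at_right 0)"
    using bound by (auto simp: eventually_at_right_field intro!: exI[of _ 1])
  ultimately show ?thesis
    using tendsto_lowerbound[of "\<lambda>e. ennreal p * (emeasure lborel E + ennreal e)"] by fastforce
qed

text \<open>
  The rational numbers \<open>p < q\<close> separate the lower and the upper derivative at \<open>x\<close>. The slopes
  are taken over intervals that contain \<open>x\<close> in their interior, because the points that have
  such intervals of a given size form an open set.
\<close>

lemma oscillating_slopes_if_not_differentiable:
  fixes \<psi> :: "real \<Rightarrow> real"
  assumes lower: "\<And>x y. x \<le> y \<Longrightarrow> y - x \<le> \<psi> y - \<psi> x"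
    and upper: "\<And>x y. x \<le> y \<Longrightarrow> \<psi> y - \<psi> x \<le> C * (y - x)"
    and cont: "continuous_on UNIV \<psi>"
    and nd: "\<not> \<psi> differentiable at x"
  obtains p q where "p \<in> \<rat>" "q \<in> \<rat>" "0 < p" "p < q"
    "\<And>d. 0 < d \<Longrightarrow> \<exists>a b. a < x \<and> x < b \<and> b - a < d \<and> \<psi> b - \<psi> a < p * (b - a)"
    "\<And>d. 0 < d \<Longrightarrow> \<exists>a b. a < x \<and> x < b \<and> b - a < d \<and> q * (b - a) < \<psi> b - \<psi> a"
proof -
  define Q where "Q y = (\<psi> y - \<psi> x) / (y - x)" for y
  have Qge: "1 \<le> Q y" and Qle: "Q y \<le> C" if "y \<noteq> x" for y
    using lower[of x y] lower[of y x] upper[of x y] upper[of y x] that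
    by (cases "x < y"; simp add: Q_def field_simps)+
  let ?l = "Liminf (at x) (\<lambda>y. ereal (Q y))" and ?u = "Limsup (at x) (\<lambda>y. ereal (Q y))"
  have l1: "1 \<le> ?l"
    by (rule Liminf_bounded) (auto simp: eventually_at_filter Qge)
  have uC: "?u \<le> ereal C"
    by (rule Limsup_bounded) (auto simp: eventually_at_filter Qle)
  have lu: "?l \<le> ?u" by (rule Liminf_le_Limsup) simp
  have "?l \<noteq> ?u"
  proof
    assume eq: "?l = ?u"
    have "?l \<noteq> \<infinity>" "?l \<noteq> -\<infinity>"
      using l1 uC eq by auto
    then obtain r where r: "?l = ereal r"
      by (metis ereal_cases)
    have "((\<lambda>y. ereal (Q y)) \<longlongrightarrow> ereal r) (at x)"
      by (rule Liminf_eq_Limsup) (use eq r in auto)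
    then have "(Q \<longlongrightarrow> r) (at x)" by simp
    then have "(\<psi> has_field_derivative r) (at x)"
      by (simp add: has_field_derivative_iff Q_def[abs_def])
    then show False using nd real_differentiable_def by blast
  qed
  then have "?l < ?u" using lu by simp
  then obtain r1 where r1: "?l < ereal (real_of_rat r1)" "ereal (real_of_rat r1) < ?u"
    using ereal_dense3 by blast
  then obtain r2 where r2: "ereal (real_of_rat r1) < ereal (real_of_rat r2)" "ereal (real_of_rat r2) < ?u"
    using ereal_dense3 by blast
  define p q where "p = real_of_rat r1" and "q = real_of_rat r2"
  have "1 < ereal p" using le_less_trans[OF l1 r1(1)] by (simp add: p_def)
  then have pq: "1 < p" "p < q" "p \<in> \<rat>" "q \<in> \<rat>"
    using r2(1) by (simp_all add: p_def q_def)
  have frp: "\<exists>\<^sub>F y in at x. Q y < p"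
  proof (rule ccontr)
    assume "\<not> ?thesis"
    then have "\<forall>\<^sub>F y in at x. ereal p \<le> ereal (Q y)" by (simp add: not_frequently not_less)
    then have "ereal p \<le> ?l" by (rule Liminf_bounded)
    then show False using r1 by (simp add: p_def)
  qed
  have frq: "\<exists>\<^sub>F y in at x. q < Q y"
  proof (rule ccontr)
    assume "\<not> ?thesis"
    then have "\<forall>\<^sub>F y in at x. ereal (Q y) \<le> ereal q" by (simp add: not_frequently not_less)
    then have "?u \<le> ereal q" by (rule Limsup_bounded)
    then show False using r2 by (simp add: q_def)
  qed
  \<comment> \<open>Slopes from \<open>x\<close> to a nearby point change little when both ends of the interval are
      moved outwards. The sign \<open>s\<close> allows for slopes below (\<open>s = -1\<close>) and above (\<open>s = 1\<close>) \<open>w\<close>.\<close>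
  have widen: "\<exists>a b. a < x \<and> x < b \<and> b - a < d \<and> 0 < s * (\<psi> b - \<psi> a - w * (b - a))"
    if fr: "\<exists>\<^sub>F y in at x. 0 < s * (Q y - w)" and d: "0 < d" for s w d
  proof -
    have "\<forall>\<^sub>F y in at x. dist y x < d/2 \<and> y \<noteq> x"
      using d by (auto simp: eventually_at intro!: exI[of _ "d/2"])
    then have "\<exists>\<^sub>F y in at x. 0 < s * (Q y - w) \<and> dist y x < d/2 \<and> y \<noteq> x"
        by (intro frequently_rev_mp[OF fr]) (auto elim: eventually_mono)
      then obtain y where y: "0 < s * (Q y - w)" "dist y x < d/2" "y \<noteq> x"
        using frequently_ex by blast
      define G where "G t = s * (\<psi> (max x y + t) - \<psi> (min x y - t) - w * ((max x y + t) - (min x y - t)))" for t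
    have "continuous_on UNIV G"
      unfolding G_def
      by (intro continuous_intros continuous_on_compose2[OF cont, where f = "\<lambda>t. _ + t"]
          continuous_on_compose2[OF cont, where f = "\<lambda>t. _ - t"]) auto
    then have "isCont G 0" by (simp add: continuous_on_eq_continuous_at)
    moreover have "0 < G 0"
    proof -
      have "G 0 = s * (Q y - w) * (max x y - min x y)"
        using y(3) unfolding G_def Q_def by (cases "x < y") (auto simp: field_simps max_def min_def)
      then show ?thesis using y by (auto simp: max_def min_def)
    qed
    ultimately have "\<forall>\<^sub>F t in at 0. 0 < G t"
      unfolding isCont_def by (rule order_tendstoD)
    then obtain e where e: "0 < e" "\<And>t. t \<noteq> 0 \<Longrightarrow> dist t 0 < e \<Longrightarrow> 0 < G t"
      unfolding eventually_at by blast
    define t where "t = min (e/2) (d/8)"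
    have t: "0 < t" "t < e" "t \<le> d/8" using e d by (auto simp: t_def)
    then have "0 < G t" using e by simp
    moreover have "max x y + t - (min x y - t) < d"
      using y t d by (auto simp: dist_real_def max_def min_def abs_if split: if_splits)
    ultimately show ?thesis using t unfolding G_def
      by (intro exI[of _ "min x y - t"] exI[of _ "max x y + t"]) auto
  qed
  show ?thesis
  proof (rule that[of p q])
    show "\<exists>a b. a < x \<and> x < b \<and> b - a < d \<and> \<psi> b - \<psi> a < p * (b - a)" if "0 < d" for d
      using widen[of "-1" p d] frp that by auto
    show "\<exists>a b. a < x \<and> x < b \<and> b - a < d \<and> q * (b - a) < \<psi> b - \<psi> a" if "0 < d" for d
      using widen[of 1 q d] frq that by auto
  qed (use pq in auto)
qed

text \<open>
  On the set \<open>E\<close> of points that have arbitrarily short intervals of slope below \<open>p\<close> and also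
  of slope above \<open>q\<close>, the covering estimate for \<open>\<psi>\<close> gives \<open>\<bar>\<psi> E\<bar> \<le> p \<bar>E\<bar>\<close>, and the
  estimate for the inverse function gives \<open>\<bar>E\<bar> \<le> \<bar>\<psi> E\<bar> / q\<close>. For \<open>p < q\<close> this forces
  \<open>\<bar>E\<bar> = 0\<close>.
\<close>

lemma negligible_nondifferentiable_bilipschitz:
  fixes \<psi> :: "real \<Rightarrow> real"
  assumes lower: "\<And>x y. x \<le> y \<Longrightarrow> y - x \<le> \<psi> y - \<psi> x"
    and upper: "\<And>x y. x \<le> y \<Longrightarrow> \<psi> y - \<psi> x \<le> C * (y - x)"
  shows "negligible {x. \<not> \<psi> differentiable at x}"
proof -
  have C1: "1 \<le> C" using lower[of 0 1] upper[of 0 1] by simp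
  have mono: "strict_mono \<psi>"
  proof (rule strict_monoI)
    fix x y :: real assume "x < y"
    then show "\<psi> x < \<psi> y" using lower[of x y] by simp
  qed
  have lip: "C-lipschitz_on UNIV \<psi>"
  proof (rule lipschitz_onI)
    fix x y
    show "dist (\<psi> x) (\<psi> y) \<le> C * dist x y"
      using lower[of x y] upper[of x y] lower[of y x] upper[of y x]
      by (cases "x \<le> y") (auto simp: dist_real_def abs_if)
  qed (use C1 in simp)
  have cont: "continuous_on UNIV \<psi>" using lip by (rule lipschitz_on_continuous_on)
  have "\<exists>x. \<psi> x = y" for y
  proof -
    define a where "a = min (y - \<psi> 0) 0"
    define b where "b = max (y - \<psi> 0) 0"
    have "\<psi> a \<le> y" "y \<le> \<psi> b" "a \<le> b"
      using lower[of a 0] lower[of 0 b] unfolding a_def b_def by linarith+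
    then show ?thesis
      using IVT'[of \<psi> a y b] continuous_on_subset[OF cont] by blast
  qed
  then obtain \<sigma> where \<psi>\<sigma>: "\<And>y. \<psi> (\<sigma> y) = y" by metis
  have \<sigma>\<psi>: "\<sigma> (\<psi> x) = x" for x
    using strict_mono_eq[OF mono] \<psi>\<sigma> by metis
  have mono\<sigma>: "strict_mono \<sigma>"
    by (rule strict_monoI) (metis \<psi>\<sigma> mono strict_mono_less)
  have lip\<sigma>: "1-lipschitz_on UNIV \<sigma>"
  proof (rule lipschitz_onI)
    fix x y
    show "dist (\<sigma> x) (\<sigma> y) \<le> 1 * dist x y"
      using lower[of "\<sigma> x" "\<sigma> y"] lower[of "\<sigma> y" "\<sigma> x"] strict_mono_less_eq[OF mono\<sigma>, of x y]
        strict_mono_less_eq[OF mono\<sigma>, of y x]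
      by (cases "x \<le> y") (auto simp: \<psi>\<sigma> dist_real_def)
  qed simp
  have cont\<sigma>: "continuous_on UNIV \<sigma>" using lip\<sigma> by (rule lipschitz_on_continuous_on)

  \<comment> \<open>Open sets of points in short intervals of small slope (\<open>A\<close>) or large slope (\<open>D\<close>); they
      make the exceptional set \<open>E\<close> a Borel set. The bound by \<open>N\<close> makes its measure finite.\<close>
  define A where "A p n = \<Union>{{a<..<b} | a b. a < b \<and> b - a < inverse (real (Suc n)) \<and> \<psi> b - \<psi> a < p * (b - a)}" for p n
  define D where "D q n = \<Union>{{a<..<b} | a b. a < b \<and> b - a < inverse (real (Suc n)) \<and> q * (b - a) < \<psi> b - \<psi> a}" for q n
  define E where "E p q N = ball 0 (real N) \<inter> (\<Inter>n. A p n \<inter> D q n)" for p q N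
  have openA: "open (A p n)" and openD: "open (D p n)" for p n
    unfolding A_def D_def by auto
  have E_borel: "E p q N \<in> sets borel" for p q N
    unfolding E_def using openA openD by (intro sets.Int sets.countable_INT) auto
  have neg: "negligible (E p q N)" if "0 < p" "p < q" for p q N
  proof -
    have fin: "emeasure lborel (E p q N) < \<infinity>"
      by (rule le_less_trans[OF emeasure_mono[of _ "ball 0 (real N)"] emeasure_bounded_finite])
         (auto simp: E_def)
    have fineA: "\<exists>a b. a < b \<and> a \<le> x \<and> x \<le> b \<and> b - a < d \<and> \<psi> b - \<psi> a \<le> p * (b - a)"
      if x: "x \<in> E p q N" and d: "0 < d" for x d
    proof -
      obtain n where n: "inverse (real (Suc n)) < d" using reals_Archimedean[OF d] by blast
      have "x \<in> A p n" using x by (auto simp: E_def)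
      then obtain a b where "a < x" "x < b" "b - a < inverse (real (Suc n))" "\<psi> b - \<psi> a < p * (b - a)"
        by (auto simp: A_def)
      with n show ?thesis by (intro exI[of _ a] exI[of _ b]) auto
    qed
    have "emeasure lborel (\<psi> ` E p q N) \<le> ennreal p * emeasure lborel (E p q N)"
      using emeasure_image_le_of_small_slopes[OF \<sigma>\<psi> \<psi>\<sigma> mono cont\<sigma> lip E_borel _ fineA] that by simp
    moreover
    \<comment> \<open>Images of intervals of slope above \<open>q\<close> are short intervals on which the inverse function
        has slope below \<open>1 / q\<close>.\<close>
    have fineD: "\<exists>a b. a < b \<and> a \<le> y \<and> y \<le> b \<and> b - a < d \<and> \<sigma> b - \<sigma> a \<le> (1/q) * (b - a)"
      if y: "y \<in> \<psi> ` E p q N" and d: "0 < d" for y d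
    proof -
      obtain x where x: "x \<in> E p q N" "y = \<psi> x" using y by blast
      have "0 < d / C" using d C1 by simp
      from reals_Archimedean[OF this] obtain n where n: "inverse (real (Suc n)) < d / C" by blast
      have "x \<in> D q n" using x by (auto simp: E_def)
      then obtain a b where ab: "a < x" "x < b" "b - a < inverse (real (Suc n))" "q * (b - a) < \<psi> b - \<psi> a"
        by (auto simp: D_def)
      have "b - a < d / C" using ab n by linarith
      then have "C * (b - a) < d" using C1 by (simp add: pos_less_divide_eq mult.commute)
      then have "\<psi> b - \<psi> a < d" using ab upper[of a b] by simp
      then show ?thesis using ab mono \<open>0 < p\<close> \<open>p < q\<close> x
        by (intro exI[of _ "\<psi> a"] exI[of _ "\<psi> b"])
           (auto simp: \<sigma>\<psi> strict_mono_less strict_mono_less_eq field_simps)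
    qed
    have "emeasure lborel (\<sigma> ` \<psi> ` E p q N) \<le> ennreal (1/q) * emeasure lborel (\<psi> ` E p q N)"
    proof (rule emeasure_image_le_of_small_slopes[OF \<psi>\<sigma> \<sigma>\<psi> mono\<sigma> cont lip\<sigma> _ _ fineD])
      have "\<psi> ` E p q N = \<sigma> -` E p q N" using \<sigma>\<psi> \<psi>\<sigma> by (auto simp: image_iff) metis
      then show "\<psi> ` E p q N \<in> sets borel"
        using measurable_sets[OF borel_measurable_continuous_onI[OF cont\<sigma>] E_borel] by simp
    qed (use that in auto)
    moreover have "\<sigma> ` \<psi> ` E p q N = E p q N" by (simp add: image_image \<sigma>\<psi>)
    ultimately have "emeasure lborel (E p q N) \<le> ennreal (1/q) * (ennreal p * emeasure lborel (E p q N))"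
      by (metis order_trans mult_left_mono zero_le)
    moreover obtain t where t: "emeasure lborel (E p q N) = ennreal t" "0 \<le> t"
      using fin by (cases "emeasure lborel (E p q N)") auto
    ultimately have "t \<le> (1/q) * (p * t)"
      using that by (simp add: ennreal_mult[symmetric])
    then have "t * (q - p) \<le> 0" using that by (simp add: field_simps)
    then have "t = 0" using t that by (metis diff_gt_0_iff_gt less_eq_real_def mult_pos_pos not_le)
    then have "E p q N \<in> null_sets lborel" using t E_borel by (simp add: null_sets_def)
    then show ?thesis by (simp add: negligible_iff_null_sets null_sets_completionI)
  qed
  define R where "R = {(p, q, N :: nat). p \<in> \<rat> \<and> q \<in> \<rat> \<and> (0::real) < p \<and> p < q}"
  have "R \<subseteq> \<rat> \<times> \<rat> \<times> (UNIV :: nat set)" by (auto simp: R_def)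
  then have "countable R"
    by (rule countable_subset) (simp add: countable_rat)
  then have "negligible (\<Union>(p, q, N)\<in>R. E p q N)"
    using neg by (intro negligible_countable_Union) (auto simp: R_def)
  moreover have "{x. \<not> \<psi> differentiable at x} \<subseteq> (\<Union>(p, q, N)\<in>R. E p q N)"
  proof
    fix x assume "x \<in> {x. \<not> \<psi> differentiable at x}"
    then have nd: "\<not> \<psi> differentiable at x" by simp
    obtain p q where pq: "p \<in> \<rat>" "q \<in> \<rat>" "0 < p" "p < q"
      and small: "\<And>d. 0 < d \<Longrightarrow> \<exists>a b. a < x \<and> x < b \<and> b - a < d \<and> \<psi> b - \<psi> a < p * (b - a)"
      and large: "\<And>d. 0 < d \<Longrightarrow> \<exists>a b. a < x \<and> x < b \<and> b - a < d \<and> q * (b - a) < \<psi> b - \<psi> a"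
      using oscillating_slopes_if_not_differentiable[OF lower upper cont nd] by blast
    obtain N where N: "\<bar>x\<bar> < real N" using reals_Archimedean2 by blast
    have "x \<in> A p n" for n
    proof -
      from small[of "inverse (real (Suc n))"] obtain a b
        where "a < x" "x < b" "b - a < inverse (real (Suc n))" "\<psi> b - \<psi> a < p * (b - a)" by auto
      then show ?thesis unfolding A_def by (intro UnionI[of "{a<..<b}"] CollectI exI[of _ a] exI[of _ b]) auto
    qed
    moreover have "x \<in> D q n" for n
    proof -
      from large[of "inverse (real (Suc n))"] obtain a b
        where "a < x" "x < b" "b - a < inverse (real (Suc n))" "q * (b - a) < \<psi> b - \<psi> a" by auto
      then show ?thesis unfolding D_def by (intro UnionI[of "{a<..<b}"] CollectI exI[of _ a] exI[of _ b]) auto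
    qed
    ultimately have "x \<in> E p q N" using N by (auto simp: E_def)
    moreover have "(p, q, N) \<in> R" using pq by (auto simp: R_def)
    ultimately show "x \<in> (\<Union>(p, q, N)\<in>R. E p q N)" by blast
  qed
  ultimately show ?thesis by (rule negligible_subset)
qed

text \<open>
  Adding a steep linear function turns a Lipschitz function into a bilipschitz one.
\<close>

lemma negligible_nondifferentiable_lipschitz_real:
  fixes u :: "real \<Rightarrow> real"
  assumes "L-lipschitz_on UNIV u"
  shows "negligible {x. \<not> u differentiable at x}"
proof -
  define \<psi> where "\<psi> x = u x + (L + 1) * x" for x
  have d: "\<bar>u y - u x\<bar> \<le> L * \<bar>y - x\<bar>" for x y
    using lipschitz_onD[OF assms, of y x] by (simp add: dist_real_def)
  have neg: "negligible {x. \<not> \<psi> differentiable at x}"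
  proof (rule negligible_nondifferentiable_bilipschitz[of \<psi> "2 * L + 1"])
    fix x y :: real assume "x \<le> y"
    then show "y - x \<le> \<psi> y - \<psi> x" "\<psi> y - \<psi> x \<le> (2 * L + 1) * (y - x)"
      using d[of y x] by (auto simp: \<psi>_def algebra_simps abs_le_iff)
  qed
  have "u differentiable at x" if "\<psi> differentiable at x" for x
  proof -
    have "(\<lambda>x. \<psi> x - (L + 1) * x) differentiable at x"
      using that by (intro differentiable_diff differentiable_mult) auto
    then show ?thesis by (simp add: \<psi>_def)
  qed
  then have "{x. \<not> u differentiable at x} \<subseteq> {x. \<not> \<psi> differentiable at x}" by blast
  with neg show ?thesis by (rule negligible_subset)
qed

lemma negligible_nondifferentiable_lipschitz_curve:
  fixes \<phi> :: "real \<Rightarrow> complex"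
  assumes "L-lipschitz_on UNIV \<phi>"
  shows "negligible {y. \<not> \<phi> differentiable at y}"
proof -
  have "L-lipschitz_on UNIV (\<lambda>y. Re (\<phi> y))" "L-lipschitz_on UNIV (\<lambda>y. Im (\<phi> y))"
    using assms abs_Re_le_cmod[of "\<phi> _ - \<phi> _"] abs_Im_le_cmod[of "\<phi> _ - \<phi> _"] order_trans
    unfolding lipschitz_on_def dist_norm real_norm_def minus_complex.simps by blast+
  then have neg: "negligible ({y. \<not> (\<lambda>y. Re (\<phi> y)) differentiable at y} \<union> {y. \<not> (\<lambda>y. Im (\<phi> y)) differentiable at y})"
    by (intro negligible_Un negligible_nondifferentiable_lipschitz_real)
  have "\<phi> differentiable at y"
    if \<phi>: "(\<lambda>y. Re (\<phi> y)) differentiable at y" "(\<lambda>y. Im (\<phi> y)) differentiable at y" for y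
  proof -
    obtain a b where "((\<lambda>y. Re (\<phi> y)) has_field_derivative a) (at y)"
        "((\<lambda>y. Im (\<phi> y)) has_field_derivative b) (at y)"
      using \<phi> by (auto simp: real_differentiable_def)
    then have "(\<phi> has_vector_derivative Complex a b) (at y)"
      by (simp add: has_vector_derivative_complex_iff has_real_derivative_iff_has_vector_derivative)
    then show ?thesis
      by (auto simp: has_vector_derivative_def differentiable_def)
  qed
  then have "{y. \<not> \<phi> differentiable at y} \<subseteq>
      {y. \<not> (\<lambda>y. Re (\<phi> y)) differentiable at y} \<union> {y. \<not> (\<lambda>y. Im (\<phi> y)) differentiable at y}"
    by blast
  with neg show ?thesis by (rule negligible_subset)
qed

lemma negligible_Im_vimage:
  assumes "negligible N"
  shows "negligible {z. Im z \<in> N}"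
proof -
  obtain N' where N': "N' \<in> null_sets lborel" "N \<subseteq> N'"
    using assms by (auto simp: negligible_iff_null_sets null_sets_completion_iff2)
  have "UNIV \<times> N' \<in> null_sets (lborel \<Otimes>\<^sub>M lborel)"
    using N' by (simp add: null_sets_def lborel.emeasure_pair_measure_Times)
  then have "negligible (UNIV \<times> N' :: (real \<times> real) set)"
    unfolding lborel_prod negligible_iff_null_sets by (rule null_sets_completionI)
  then have "negligible ((\<lambda>(x, y). Complex x y) ` (UNIV \<times> N'))"
  proof (rule negligible_differentiable_image_negligible[rotated])
    have "(\<lambda>p. of_real (fst p) + \<i> * of_real (snd p) :: complex) differentiable_on UNIV \<times> N'"
      by (intro bounded_linear_imp_differentiable_on bounded_linear_add
           bounded_linear_compose[OF bounded_linear_mult_right]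
           bounded_linear_compose[OF bounded_linear_of_real] bounded_linear_fst bounded_linear_snd)
    moreover have "(\<lambda>(x, y). Complex x y) = (\<lambda>p. of_real (fst p) + \<i> * of_real (snd p))"
      by (auto simp: fun_eq_iff complex_eq_iff)
    ultimately show "(\<lambda>(x, y). Complex x y) differentiable_on UNIV \<times> N'" by simp
  qed simp
  moreover have "{z. Im z \<in> N} \<subseteq> (\<lambda>(x, y). Complex x y) ` (UNIV \<times> N')"
  proof
    fix z assume "z \<in> {z. Im z \<in> N}"
    then show "z \<in> (\<lambda>(x, y). Complex x y) ` (UNIV \<times> N')"
      using N' by (intro image_eqI[of _ _ "(Re z, Im z)"]) auto
  qed
  ultimately show ?thesis by (rule negligible_subset)
qed

section \<open>Weak derivatives of locally Lipschitz functions\<close>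

lemma difference_quotients_tendsto_partial_deriv:
  assumes "f differentiable at z"
  shows "(\<lambda>n. of_nat (Suc n) * (f (z + v / of_nat (Suc n)) - f z)) \<longlonglongrightarrow> partial_deriv v f z"
proof (cases "v = 0")
  case True
  have "linear (frechet_derivative f (at z))"
    using assms by (rule linear_frechet_derivative)
  then have "frechet_derivative f (at z) 0 = 0" by (rule linear_0)
  with True show ?thesis by (simp add: partial_deriv_def)
next
  case False
  define D where "D = frechet_derivative f (at z)"
  define w where "w n = v / of_nat (Suc n)" for n
  have der: "(f has_derivative D) (at z)"
    using assms by (simp add: frechet_derivative_works D_def)
  then have lim: "((\<lambda>h. norm (f (z + h) - f z - D h) / norm h) \<longlongrightarrow> 0) (at 0)"
    by (simp add: has_derivative_at)
  have "w \<longlonglongrightarrow> 0"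
    using tendsto_scaleR[OF LIMSEQ_inverse_real_of_nat tendsto_const[of v]]
    by (simp add: w_def[abs_def] scaleR_conv_of_real divide_inverse mult.commute)
  then have "filterlim w (at 0) sequentially"
    using False by (auto simp: filterlim_at w_def simp del: of_nat_Suc)
  from filterlim_compose[OF lim this]
  have "(\<lambda>n. norm (f (z + w n) - f z - D (w n)) / norm (w n) * norm v) \<longlonglongrightarrow> 0"
    by (rule tendsto_mult_left_zero)
  moreover have "norm (f (z + w n) - f z - D (w n)) / norm (w n) * norm v
      = norm (of_nat (Suc n) * (f (z + w n) - f z) - D v)" for n
  proof -
    have "D (w n) = D v / of_nat (Suc n)"
    proof -
      have "w n = (1 / real (Suc n)) *\<^sub>R v" by (simp add: w_def scaleR_conv_of_real)
      then have "D (w n) = (1 / real (Suc n)) *\<^sub>R D v"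
        using has_derivative_bounded_linear[OF der] by (simp add: linear_simps)
      then show ?thesis by (simp add: scaleR_conv_of_real)
    qed
    then have "of_nat (Suc n) * (f (z + w n) - f z) - D v = of_nat (Suc n) * (f (z + w n) - f z - D (w n))"
      by (simp add: right_diff_distrib del: of_nat_Suc)
    moreover have "norm (of_nat (Suc n) * X) = norm X / norm (w n) * norm v" for X :: complex
      using False by (simp add: w_def norm_mult norm_divide del: of_nat_Suc)
    ultimately show ?thesis by presburger
  qed
  ultimately have "(\<lambda>n. norm (of_nat (Suc n) * (f (z + w n) - f z) - D v)) \<longlonglongrightarrow> 0" by simp
  then have "(\<lambda>n. of_nat (Suc n) * (f (z + w n) - f z)) \<longlonglongrightarrow> D v"
    using LIM_zero_cancel tendsto_norm_zero_iff by blast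
  then show ?thesis by (simp add: w_def D_def partial_deriv_def)
qed

text \<open>
  Integrals are invariant under translation, so the difference quotients of \<open>u\<close> have
  integral 0. The Lipschitz constant and the compact support dominate them, and they converge
  to the partial derivative.
\<close>

lemma integral_partial_deriv_eq_0:
  assumes lip: "L-lipschitz_on UNIV u"
    and supp: "\<And>z. R \<le> norm z \<Longrightarrow> u z = 0"
    and N: "negligible N" and diff: "\<And>z. z \<notin> N \<Longrightarrow> u differentiable at z"
  shows "integrable lebesgue (partial_deriv v u)" "integral\<^sup>L lebesgue (partial_deriv v u) = 0"
proof -
  have cont: "continuous_on UNIV u" using lip by (rule lipschitz_on_continuous_on)
  have intu: "integrable lborel u"
  proof -
    have "integrable lborel (\<lambda>z. indicator (cball 0 R) z *\<^sub>R u z)"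
      using continuous_on_subset[OF cont] by (intro borel_integrable_compact) auto
    moreover have "indicator (cball 0 R) z *\<^sub>R u z = u z" for z
      using supp[of z] by (auto simp: indicator_def)
    ultimately show ?thesis by simp
  qed
  have shift: "integrable lborel (\<lambda>z. u (z + w))" "integral\<^sup>L lborel (\<lambda>z. u (z + w)) = integral\<^sup>L lborel u" for w
  proof -
    have "u \<in> borel_measurable borel" using cont by (rule borel_measurable_continuous_onI)
    then show "integrable lborel (\<lambda>z. u (z + w))" "integral\<^sup>L lborel (\<lambda>z. u (z + w)) = integral\<^sup>L lborel u"
      using intu integrable_distr_eq[of "(+) w" lborel borel u] integral_distr[of "(+) w" lborel borel u]
      by (simp_all add: lborel_distr_plus add.commute)
  qed
  define s where "s n z = of_nat (Suc n) * (u (z + v / of_nat (Suc n)) - u z)" for n z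
  define b where "b z = indicator (cball 0 (R + norm v)) z *\<^sub>R (L * norm v)" for z :: complex
  have s_borel: "s n \<in> borel_measurable borel" for n
    unfolding s_def using cont
    by (intro borel_measurable_continuous_onI continuous_intros continuous_on_compose2[OF cont, where f = "\<lambda>z. z + _"]) auto
  have s_meas: "s n \<in> borel_measurable lebesgue" for n
    using s_borel by (intro measurable_completion) simp
  have s_int: "integral\<^sup>L lebesgue (s n) = 0" for n
  proof -
    have "integral\<^sup>L lebesgue (s n) = integral\<^sup>L lborel (s n)"
      using s_borel by (intro integral_completion) simp
    also have "\<dots> = 0"
      unfolding s_def using shift intu by (simp add: integral_diff del: of_nat_Suc)
    finally show ?thesis .
  qed
  have lim: "AE z in lebesgue. (\<lambda>n. s n z) \<longlonglongrightarrow> partial_deriv v u z"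
    using N difference_quotients_tendsto_partial_deriv[OF diff, of _ v]
    unfolding s_def by (intro AE_I'[of N]) (auto simp: negligible_iff_null_sets)
  have meas: "partial_deriv v u \<in> borel_measurable lebesgue"
  proof (rule borel_measurable_AE)
    show "(\<lambda>z. lim (\<lambda>n. s n z)) \<in> borel_measurable lebesgue"
      using s_meas by (rule borel_measurable_lim_metric)
    show "AE z in lebesgue. lim (\<lambda>n. s n z) = partial_deriv v u z"
      using lim by eventually_elim (rule limI)
  qed
  have b_int: "integrable lebesgue b"
    unfolding b_def by (intro integrable_scaleR_left)
      (use emeasure_bounded_finite[OF bounded_cball[of "0::complex" "R + norm v"]] in
        \<open>simp add: integrable_indicator_iff\<close>)
  have le: "norm (s n z) \<le> b z" for n z
  proof -
    have *: "norm (v / of_nat (Suc n)) \<le> norm v"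
      by (simp add: norm_divide divide_le_eq mult_le_cancel_left1 del: of_nat_Suc)
    show ?thesis
    proof (cases "z \<in> cball 0 (R + norm v)")
      case True
      have "norm (s n z) = real (Suc n) * norm (u (z + v / of_nat (Suc n)) - u z)"
        by (simp add: s_def norm_mult del: of_nat_Suc)
      also have "\<dots> \<le> real (Suc n) * (L * norm (v / of_nat (Suc n)))"
        using lipschitz_on_normD[OF lip, of "z + v / of_nat (Suc n)" z] by (intro mult_left_mono) auto
      also have "\<dots> = L * norm v" by (simp add: norm_divide del: of_nat_Suc)
      finally show ?thesis using True by (simp add: b_def)
    next
      case False
      then have "R \<le> norm z" "R \<le> norm (z + v / of_nat (Suc n))"
        using * norm_triangle_ineq2[of z "- (v / of_nat (Suc n))"] norm_ge_zero[of v]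
        by (auto simp del: of_nat_Suc norm_ge_zero)
      then show ?thesis using False by (simp add: s_def b_def supp)
    qed
  qed
  show "integrable lebesgue (partial_deriv v u)"
    using meas s_meas b_int lim le by (intro integrable_dominated_convergence[of _ _ s b]) auto
  have "(\<lambda>n. integral\<^sup>L lebesgue (s n)) \<longlonglongrightarrow> integral\<^sup>L lebesgue (partial_deriv v u)"
    using meas s_meas b_int lim le by (intro integral_dominated_convergence[of _ _ s b]) auto
  then show "integral\<^sup>L lebesgue (partial_deriv v u) = 0"
    using s_int LIMSEQ_unique[OF _ tendsto_const] by auto
qed

lemma compact_enlarge:
  fixes C :: "complex set"
  assumes "compact C" "open D" "C \<subseteq> D"
  obtains d C' where "0 < d" "compact C'" "C' \<subseteq> D" "\<And>z w. z \<in> C \<Longrightarrow> dist z w \<le> d \<Longrightarrow> w \<in> C'"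
proof -
  obtain d where d: "0 < d" "(\<Union>x\<in>C. cball x d) \<subseteq> D"
    using compact_subset_open_imp_cball_epsilon_subset[OF assms] by blast
  have "compact {x + y |x y. x \<in> C \<and> y \<in> cball 0 d}"
    using assms by (intro compact_sums) auto
  moreover have "{x + y |x y. x \<in> C \<and> y \<in> cball 0 d} \<subseteq> D"
    using d by (fastforce simp: dist_norm)
  moreover have "w \<in> {x + y |x y. x \<in> C \<and> y \<in> cball 0 d}" if "z \<in> C" "dist z w \<le> d" for z w
  proof -
    have "w = z + (w - z)" "w - z \<in> cball 0 d"
      using that by (auto simp: dist_norm norm_minus_commute)
    with that show ?thesis by blast
  qed
  ultimately show ?thesis using that d by blast
qed

lemma absolutely_integrable_continuous_compact:
  fixes f :: "complex \<Rightarrow> complex"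
  assumes "compact C" "continuous_on C f"
  shows "f absolutely_integrable_on C"
proof -
  have "integrable lborel (\<lambda>z. indicator C z *\<^sub>R f z)"
    using assms by (rule borel_integrable_compact)
  then show ?thesis
    unfolding set_integrable_def
    by (subst integrable_completion) (auto simp: borel_measurable_integrable)
qed

text \<open>
  Measurability and boundedness of the partial derivative on a compact set both come from the
  difference quotients, which are continuous there as soon as the step is short.
\<close>

lemma partial_deriv_locally_L1:
  assumes D: "open D"
    and lip: "\<And>C. compact C \<Longrightarrow> C \<subseteq> D \<Longrightarrow> \<exists>L. L-lipschitz_on C f"
    and N: "negligible N" and diff: "\<And>z. z \<in> D - N \<Longrightarrow> f differentiable at z"
  shows "locally_L1 D (partial_deriv v f)"
  unfolding locally_L1_def
proof (intro allI impI, elim conjE)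
  fix C assume C: "compact C" "C \<subseteq> D"
  obtain d C' where d: "0 < d" "compact C'" "C' \<subseteq> D"
      and C': "\<And>z w. z \<in> C \<Longrightarrow> dist z w \<le> d \<Longrightarrow> w \<in> C'"
    using compact_enlarge[OF C(1) D C(2)] by blast
  obtain L where L: "L-lipschitz_on C' f" using lip d by blast
  have cont: "continuous_on C' f" using L by (rule lipschitz_on_continuous_on)
  \<comment> \<open>From the index \<open>n0\<close> on, the shifted points stay in \<open>C'\<close>.\<close>
  obtain n0 where n0: "norm v / d \<le> real n0" using real_arch_simple by blast
  define w where "w n = v / of_nat (Suc (n + n0))" for n
  have w: "norm (w n) \<le> d" for n
  proof -
    have "norm v / d \<le> real (Suc (n + n0))" using n0 by simp
    then show ?thesis using d by (simp add: w_def norm_divide field_simps del: of_nat_Suc)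
  qed
  have inC': "z + w n \<in> C'" "z \<in> C'" if "z \<in> C" for z n
    using that w[of n] d(1) by (auto intro!: C' simp: dist_norm)
  define s where "s n z = of_nat (Suc (n + n0)) * (f (z + w n) - f z)" for n z
  have s_int: "s n absolutely_integrable_on C" for n
    unfolding s_def using C(1)
    by (intro absolutely_integrable_continuous_compact continuous_intros
        continuous_on_compose2[OF cont, where f = "\<lambda>z. z + _"] continuous_on_subset[OF cont])
       (auto intro: inC')
  have s_le: "norm (s n z) \<le> L * norm v" if "z \<in> C" for n z
  proof -
    have "norm (s n z) = real (Suc (n + n0)) * norm (f (z + w n) - f z)"
      by (simp add: s_def norm_mult del: of_nat_Suc)
    also have "\<dots> \<le> real (Suc (n + n0)) * (L * norm (w n))"
      using lipschitz_on_normD[OF L inC'[OF that]] by (intro mult_left_mono) auto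
    also have "\<dots> = L * norm v" by (simp add: w_def norm_divide del: of_nat_Suc)
    finally show ?thesis .
  qed
  have lim: "(\<lambda>n. s n z) \<longlonglongrightarrow> partial_deriv v f z" if "z \<in> C - N" for z
    using LIMSEQ_ignore_initial_segment[OF difference_quotients_tendsto_partial_deriv[OF diff, of z v], of n0] that C
    by (auto simp: s_def w_def)
  have "(\<lambda>z. if z \<in> N then 0 else partial_deriv v f z) absolutely_integrable_on C"
  proof (rule dominated_convergence_absolutely_integrable)
    show "(\<lambda>z. if z \<in> N then 0 else s n z) absolutely_integrable_on C" for n
      by (rule absolutely_integrable_spike[OF s_int N]) auto
    show "(\<lambda>z. L * norm v) integrable_on C"
      using C(1) by (intro integrable_on_const lmeasurable_compact)
    show "(\<lambda>n. if z \<in> N then 0 else s n z) \<longlonglongrightarrow> (if z \<in> N then 0 else partial_deriv v f z)" if "z \<in> C" for z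
      using lim that by auto
    show "norm (if z \<in> N then 0 else partial_deriv v f z) \<le> L * norm v" if "z \<in> C" for z
    proof (cases "z \<in> N")
      case True
      then show ?thesis using lipschitz_on_nonneg[OF L] by simp
    next
      case False
      then show ?thesis
        using Lim_norm_ubound[OF _ lim[of z]] s_le that by simp
    qed
  qed
  then show "partial_deriv v f absolutely_integrable_on C"
    by (rule absolutely_integrable_spike[OF _ N]) auto
qed

lemma test_function_support:
  assumes "test_function D \<theta>"
  obtains K where "compact K" "K \<subseteq> D" "\<And>z. z \<notin> K \<Longrightarrow> \<theta> z = 0"
    "\<And>z. z \<notin> K \<Longrightarrow> (\<theta> has_derivative (\<lambda>_. 0)) (at z)"
proof -
  define K where "K = closure {z. \<theta> z \<noteq> 0}"
  have K: "compact K" "K \<subseteq> D"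
    using assms by (auto simp: test_function_def K_def)
  have zero: "\<theta> z = 0" if "z \<notin> K" for z
    using that closure_subset[of "{z. \<theta> z \<noteq> 0}"] unfolding K_def by blast
  have der: "(\<theta> has_derivative (\<lambda>_. 0)) (at z)" if "z \<notin> K" for z
    by (rule has_derivative_transform_within_open[of "\<lambda>_. 0" _ z UNIV "- K"])
       (use that zero compact_imp_closed[OF K(1)] in auto)
  show ?thesis
    by (rule that[OF K zero der])
qed

lemma test_function_differentiable:
  assumes "test_function D \<theta>"
  shows "\<theta> differentiable at z" "continuous_on UNIV (partial_deriv 1 \<theta>)" "continuous_on UNIV (partial_deriv \<i> \<theta>)"
proof -
  have "k_smooth (Suc 0) \<theta>" using assms unfolding test_function_def by blast
  then show "\<theta> differentiable at z" "continuous_on UNIV (partial_deriv 1 \<theta>)" "continuous_on UNIV (partial_deriv \<i> \<theta>)"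
    by simp_all
qed

lemma test_function_lipschitz:
  assumes "test_function D \<theta>"
  obtains L where "L-lipschitz_on UNIV \<theta>"
proof -
  obtain K where K: "compact K" "\<And>z. z \<notin> K \<Longrightarrow> (\<theta> has_derivative (\<lambda>_. 0)) (at z)"
    by (rule test_function_support[OF assms]) (rule that)
  note \<theta> = test_function_differentiable[OF assms]
  have "bounded (partial_deriv 1 \<theta> ` K)"
    by (rule compact_imp_bounded[OF compact_continuous_image[OF continuous_on_subset[OF \<theta>(2)] K(1)]]) simp
  moreover have "bounded (partial_deriv \<i> \<theta> ` K)"
    by (rule compact_imp_bounded[OF compact_continuous_image[OF continuous_on_subset[OF \<theta>(3)] K(1)]]) simp
  ultimately obtain A B where AB: "\<And>z. z \<in> K \<Longrightarrow> norm (partial_deriv 1 \<theta> z) \<le> A"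
      "\<And>z. z \<in> K \<Longrightarrow> norm (partial_deriv \<i> \<theta> z) \<le> B"
    unfolding bounded_iff by blast
  define M where "M = max A 0 + max B 0"
  have "onorm (frechet_derivative \<theta> (at z)) \<le> M" for z
  proof (rule onorm_bound)
    fix w
    let ?D = "frechet_derivative \<theta> (at z)"
    have lin: "linear ?D" using \<theta>(1) by (rule linear_frechet_derivative)
    have "?D w = ?D (Re w *\<^sub>R 1 + Im w *\<^sub>R \<i>)"
      by (rule arg_cong[of _ _ ?D]) (simp add: complex_eq_iff)
    also have "\<dots> = Re w *\<^sub>R ?D 1 + Im w *\<^sub>R ?D \<i>"
      by (simp only: linear_add[OF lin] linear_scale[OF lin])
    also have "norm \<dots> \<le> \<bar>Re w\<bar> * norm (?D 1) + \<bar>Im w\<bar> * norm (?D \<i>)"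
      by (metis norm_scaleR norm_triangle_ineq)
    also have "\<dots> \<le> norm w * max A 0 + norm w * max B 0"
    proof (cases "z \<in> K")
      case True
      then show ?thesis
        using AB[of z] abs_Re_le_cmod[of w] abs_Im_le_cmod[of w]
        by (intro add_mono mult_mono) (auto simp: partial_deriv_def)
    next
      case False
      then have "?D = (\<lambda>_. 0)" using K(2) frechet_derivative_at by metis
      then show ?thesis by simp
    qed
    finally show "norm (?D w) \<le> M * norm w" by (simp add: M_def algebra_simps)
  qed (simp add: M_def)
  then have "norm (\<theta> x - \<theta> y) \<le> M * norm (x - y)" for x y
    using \<theta>(1) by (intro differentiable_bound[of UNIV \<theta> "\<lambda>z. frechet_derivative \<theta> (at z)"])
       (auto simp: frechet_derivative_works)
  then have "M-lipschitz_on UNIV \<theta>"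
    by (intro lipschitz_onI) (auto simp: dist_norm M_def)
  then show ?thesis by (rule that)
qed

text \<open>
  With this, integration by parts for \<open>f\<close> and \<open>\<theta>\<close> reduces to the vanishing integral of
  a partial derivative of a single compactly supported Lipschitz function.
\<close>

lemma lipschitz_times_test_function:
  assumes D: "open D"
    and lip: "\<And>C. compact C \<Longrightarrow> C \<subseteq> D \<Longrightarrow> \<exists>L. L-lipschitz_on C f"
    and \<theta>: "test_function D \<theta>"
  obtains L where "L-lipschitz_on UNIV (\<lambda>z. if z \<in> D then f z * \<theta> z else 0)"
proof -
  obtain K where K: "compact K" "K \<subseteq> D" "\<And>z. z \<notin> K \<Longrightarrow> \<theta> z = 0"
    using test_function_support[OF \<theta>] by metis
  obtain L\<theta> where L\<theta>: "L\<theta>-lipschitz_on UNIV \<theta>"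
    using test_function_lipschitz[OF \<theta>] by metis
  obtain d K' where d: "0 < d" and K': "compact K'" "K' \<subseteq> D"
      and near: "\<And>z w. z \<in> K \<Longrightarrow> dist z w \<le> d \<Longrightarrow> w \<in> K'"
    using compact_enlarge[OF K(1) D K(2)] by metis
  obtain Lf where Lf: "Lf-lipschitz_on K' f" using lip K' by blast
  have "bounded (f ` K')" "bounded (\<theta> ` K')"
    using K'(1) lipschitz_on_continuous_on[OF Lf] continuous_on_subset[OF lipschitz_on_continuous_on[OF L\<theta>]]
    by (auto intro!: compact_imp_bounded compact_continuous_image)
  then obtain A B where A: "\<And>z. z \<in> K' \<Longrightarrow> norm (f z) \<le> A" and B: "\<And>z. z \<in> K' \<Longrightarrow> norm (\<theta> z) \<le> B"
    unfolding bounded_iff by blast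
  define u where "u z = (if z \<in> D then f z * \<theta> z else 0)" for z
  define L where "L = max A 0 * L\<theta> + max B 0 * Lf + max A 0 * max B 0 / d"
  have nonneg: "0 \<le> Lf" "0 \<le> L\<theta>" using lipschitz_on_nonneg Lf L\<theta> by blast+
  have u0: "u z = 0" if "z \<notin> K" for z using that K(3) by (simp add: u_def)
  have KK': "K \<subseteq> K'" using near d by fastforce
  \<comment> \<open>A point outside \<open>K'\<close> has distance more than \<open>d\<close> from the support, and then the
      supremum of \<open>f * \<theta>\<close> gives the bound.\<close>
  have main: "norm (u x - u y) \<le> L * norm (x - y)" if x: "x \<in> K" for x y
  proof (cases "y \<in> K'")
    case True
    have xK': "x \<in> K'" using x KK' by blast
    have "u x - u y = f x * (\<theta> x - \<theta> y) + \<theta> y * (f x - f y)"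
      using True xK' K' by (auto simp: u_def algebra_simps)
    also have "norm \<dots> \<le> norm (f x) * norm (\<theta> x - \<theta> y) + norm (\<theta> y) * norm (f x - f y)"
      by (metis norm_mult norm_triangle_ineq)
    also have "\<dots> \<le> max A 0 * (L\<theta> * norm (x - y)) + max B 0 * (Lf * norm (x - y))"
      using A[OF xK'] B[OF True] lipschitz_on_normD[OF L\<theta>, of x y] lipschitz_on_normD[OF Lf xK' True]
      by (intro add_mono mult_mono) auto
    also have "\<dots> = (max A 0 * L\<theta> + max B 0 * Lf) * norm (x - y)"
      by (simp add: algebra_simps)
    also have "\<dots> \<le> L * norm (x - y)"
      using d by (intro mult_right_mono) (auto simp: L_def)
    finally show ?thesis .
  next
    case False
    then have far: "d < norm (x - y)" using near[OF x, of y] by (cases "dist x y \<le> d") (auto simp: dist_norm)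
    have "u y = 0" using False KK' u0 by blast
    then have "norm (u x - u y) = norm (f x) * norm (\<theta> x)"
      using x K by (auto simp: u_def norm_mult)
    also have "\<dots> \<le> max A 0 * max B 0"
      using A[of x] B[of x] x KK' by (intro mult_mono) auto
    also have "\<dots> = (max A 0 * max B 0 / d) * d" using d by simp
    also have "\<dots> \<le> L * norm (x - y)"
      using far d nonneg by (intro mult_mono) (auto simp: L_def)
    finally show ?thesis .
  qed
  have "L-lipschitz_on UNIV u"
  proof (rule lipschitz_onI)
    show "0 \<le> L" using nonneg d by (auto simp: L_def)
    then show "dist (u x) (u y) \<le> L * dist x y" for x y
      using main[of x y] main[of y x] u0[of x] u0[of y]
      by (cases "x \<in> K"; cases "y \<in> K") (auto simp: dist_norm norm_minus_commute)
  qed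
  then show ?thesis using that unfolding u_def by blast
qed

text \<open>
  The integral of the partial derivative of \<open>f * \<theta>\<close> vanishes, and the product rule holds
  almost everywhere.
\<close>

lemma weak_partial_deriv:
  assumes D: "open D"
    and lip: "\<And>C. compact C \<Longrightarrow> C \<subseteq> D \<Longrightarrow> \<exists>L. L-lipschitz_on C f"
    and N: "negligible N" and diff: "\<And>z. z \<in> D - N \<Longrightarrow> f differentiable at z"
    and \<theta>: "test_function D \<theta>" and v: "v = 1 \<or> v = \<i>"
  shows "integrable (lebesgue_on D) (\<lambda>z. f z * partial_deriv v \<theta> z)"
    "integrable (lebesgue_on D) (\<lambda>z. partial_deriv v f z * \<theta> z)"
    "(LINT z|lebesgue_on D. f z * partial_deriv v \<theta> z) = - (LINT z|lebesgue_on D. partial_deriv v f z * \<theta> z)"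
proof -
  obtain K where K: "compact K" "K \<subseteq> D" "\<And>z. z \<notin> K \<Longrightarrow> \<theta> z = 0"
      "\<And>z. z \<notin> K \<Longrightarrow> (\<theta> has_derivative (\<lambda>_. 0)) (at z)"
    using test_function_support[OF \<theta>] by metis
  define u where "u z = (if z \<in> D then f z * \<theta> z else 0)" for z
  define F where "F z = indicator D z *\<^sub>R (f z * partial_deriv v \<theta> z)" for z
  define G where "G z = indicator D z *\<^sub>R (partial_deriv v f z * \<theta> z)" for z
  obtain L where "L-lipschitz_on UNIV u"
    using lipschitz_times_test_function[OF D lip \<theta>] unfolding u_def by metis
  have d\<theta>0: "partial_deriv v \<theta> z = 0" if "z \<notin> K" for z
    unfolding partial_deriv_def frechet_derivative_at[OF K(4)[OF that], symmetric] by simp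
  have du_in: "u differentiable at z \<and> partial_deriv v u z = f z * partial_deriv v \<theta> z + partial_deriv v f z * \<theta> z"
    if z: "z \<in> D - N" for z
  proof -
    have "((\<lambda>z. f z * \<theta> z) has_derivative
        (\<lambda>w. f z * frechet_derivative \<theta> (at z) w + frechet_derivative f (at z) w * \<theta> z)) (at z)"
      using diff[OF z] test_function_differentiable(1)[OF \<theta>, of z]
      by (intro has_derivative_mult) (simp_all add: frechet_derivative_works)
    then have *: "(u has_derivative
        (\<lambda>w. f z * frechet_derivative \<theta> (at z) w + frechet_derivative f (at z) w * \<theta> z)) (at z)"
      by (rule has_derivative_transform_within_open[OF _ D]) (use z in \<open>auto simp: u_def\<close>)
    show ?thesis
      unfolding partial_deriv_def frechet_derivative_at[OF *, symmetric]
      using * by (auto simp: differentiable_def)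
  qed
  have du_out: "u differentiable at z \<and> partial_deriv v u z = 0" if z: "z \<notin> K" for z
  proof -
    have *: "(u has_derivative (\<lambda>_. 0)) (at z)"
      by (rule has_derivative_transform_within_open[of "\<lambda>_. 0" _ z UNIV "- K"])
         (use z K(3) compact_imp_closed[OF K(1)] in \<open>auto simp: u_def\<close>)
    show ?thesis
      unfolding partial_deriv_def frechet_derivative_at[OF *, symmetric]
      using * by (auto simp: differentiable_def)
  qed
  obtain R where R: "\<And>z. z \<in> K \<Longrightarrow> norm z < R"
    using compact_imp_bounded[OF K(1)] bounded_pos_less by metis
  have u_zero: "u z = 0" if "R \<le> norm z" for z
    using that R[of z] K(3)[of z] by (auto simp: u_def)
  have u_diff: "u differentiable at z" if "z \<notin> N" for z
    using du_in[of z] du_out[of z] that K(2) by blast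
  have u_int: "integrable lebesgue (partial_deriv v u)" "integral\<^sup>L lebesgue (partial_deriv v u) = 0"
    using integral_partial_deriv_eq_0[OF \<open>L-lipschitz_on UNIV u\<close> u_zero N u_diff] by blast+
  have F_int: "integrable lebesgue F"
  proof -
    obtain Lf where "Lf-lipschitz_on K f" using lip K by blast
    then have "continuous_on K f" by (rule lipschitz_on_continuous_on)
    moreover have "continuous_on K (partial_deriv v \<theta>)"
      using v test_function_differentiable(2,3)[OF \<theta>] continuous_on_subset by blast
    ultimately have "(\<lambda>z. f z * partial_deriv v \<theta> z) absolutely_integrable_on K"
      using K(1) by (intro absolutely_integrable_continuous_compact continuous_intros)
    then have "integrable lebesgue (\<lambda>z. indicator K z *\<^sub>R (f z * partial_deriv v \<theta> z))"
      by (simp add: set_integrable_def)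
    moreover have "(\<lambda>z. indicator K z *\<^sub>R (f z * partial_deriv v \<theta> z)) = F"
      using K(2) d\<theta>0 by (auto simp: F_def fun_eq_iff indicator_def)
    ultimately show ?thesis by simp
  qed
  have split: "AE z in lebesgue. partial_deriv v u z - F z = G z"
  proof (rule AE_I'[of N])
    show "N \<in> null_sets lebesgue" using N by (simp add: negligible_iff_null_sets)
    have "partial_deriv v u z - F z = G z" if "z \<notin> N" for z
    proof (cases "z \<in> D")
      case True
      then show ?thesis using du_in that by (simp add: F_def G_def)
    next
      case False
      then have "z \<notin> K" using K(2) by blast
      then show ?thesis using du_out False by (simp add: F_def G_def)
    qed
    then show "{z \<in> space lebesgue. \<not> partial_deriv v u z - F z = G z} \<subseteq> N" by auto
  qed
  have diff_int: "integrable lebesgue (\<lambda>z. partial_deriv v u z - F z)"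
    using u_int F_int by simp
  then have G_meas: "G \<in> borel_measurable lebesgue"
    using split borel_measurable_AE borel_measurable_integrable by blast
  have G_int: "integrable lebesgue G"
    using integrable_cong_AE_imp[OF diff_int G_meas] split by (auto elim: eventually_mono)
  have "integral\<^sup>L lebesgue G = integral\<^sup>L lebesgue (\<lambda>z. partial_deriv v u z - F z)"
    using diff_int G_meas split by (intro integral_cong_AE) (auto elim: eventually_mono)
  also have "\<dots> = - integral\<^sup>L lebesgue F"
    using u_int F_int by simp
  finally have FG: "integral\<^sup>L lebesgue F = - integral\<^sup>L lebesgue G" by simp
  have Dm: "D \<inter> space lebesgue \<in> sets lebesgue" using D by auto
  show "integrable (lebesgue_on D) (\<lambda>z. f z * partial_deriv v \<theta> z)"
    "integrable (lebesgue_on D) (\<lambda>z. partial_deriv v f z * \<theta> z)"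
    using F_int G_int unfolding F_def[abs_def] G_def[abs_def] integrable_restrict_space[OF Dm] set_integrable_def by auto
  show "(LINT z|lebesgue_on D. f z * partial_deriv v \<theta> z) = - (LINT z|lebesgue_on D. partial_deriv v f z * \<theta> z)"
    using FG unfolding F_def[abs_def] G_def[abs_def] integral_restrict_space[OF Dm] by simp
qed

lemma weak_wirtinger_of_locally_lipschitz:
  assumes D: "open D"
    and lip: "\<And>C. compact C \<Longrightarrow> C \<subseteq> D \<Longrightarrow> \<exists>L. L-lipschitz_on C f"
    and N: "negligible N" and diff: "\<And>z. z \<in> D - N \<Longrightarrow> f differentiable at z"
  shows "weak_wirtinger D f (wirtinger f)" "weak_wirtinger_bar D f (wirtinger_bar f)"
proof -
  have L1f: "locally_L1 D f"
    unfolding locally_L1_def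
    using lip lipschitz_on_continuous_on absolutely_integrable_continuous_compact by blast
  note L1d = partial_deriv_locally_L1[OF D lip N diff]
  have eq: "wirtinger g = (\<lambda>z. (1/2) * partial_deriv 1 g z + (-\<i>/2) * partial_deriv \<i> g z)"
    "wirtinger_bar g = (\<lambda>z. (1/2) * partial_deriv 1 g z + (\<i>/2) * partial_deriv \<i> g z)" for g
    by (auto simp: fun_eq_iff wirtinger_def wirtinger_bar_def field_simps)
  have L1: "locally_L1 D (\<lambda>z. a * partial_deriv 1 f z + b * partial_deriv \<i> f z)" for a b
    using L1d[of 1] L1d[of \<i>] unfolding locally_L1_def
    by (auto intro!: set_integral_add set_integrable_mult_right)
  have int: "(LINT z|lebesgue_on D. f z * (a * partial_deriv 1 \<theta> z + b * partial_deriv \<i> \<theta> z))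
      = - (LINT z|lebesgue_on D. (a * partial_deriv 1 f z + b * partial_deriv \<i> f z) * \<theta> z)"
    if \<theta>: "test_function D \<theta>" for \<theta> a b
  proof -
    note w1 = weak_partial_deriv[OF D lip N diff \<theta>, of 1, simplified]
    note wi = weak_partial_deriv[OF D lip N diff \<theta>, of \<i>, simplified]
    have "(LINT z|lebesgue_on D. f z * (a * partial_deriv 1 \<theta> z + b * partial_deriv \<i> \<theta> z))
      = (LINT z|lebesgue_on D. a * (f z * partial_deriv 1 \<theta> z) + b * (f z * partial_deriv \<i> \<theta> z))"
      by (intro Bochner_Integration.integral_cong) (auto simp: algebra_simps)
    also have "\<dots> = a * (LINT z|lebesgue_on D. f z * partial_deriv 1 \<theta> z)
        + b * (LINT z|lebesgue_on D. f z * partial_deriv \<i> \<theta> z)"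
      using w1(1) wi(1) by simp
    also have "\<dots> = - (a * (LINT z|lebesgue_on D. partial_deriv 1 f z * \<theta> z)
        + b * (LINT z|lebesgue_on D. partial_deriv \<i> f z * \<theta> z))"
      by (simp add: w1(3) wi(3))
    also have "\<dots> = - (LINT z|lebesgue_on D. a * (partial_deriv 1 f z * \<theta> z) + b * (partial_deriv \<i> f z * \<theta> z))"
      using w1(2) wi(2) by simp
    also have "\<dots> = - (LINT z|lebesgue_on D. (a * partial_deriv 1 f z + b * partial_deriv \<i> f z) * \<theta> z)"
      by (intro arg_cong[of _ _ uminus] Bochner_Integration.integral_cong) (auto simp: algebra_simps)
    finally show ?thesis .
  qed
  show "weak_wirtinger D f (wirtinger f)" "weak_wirtinger_bar D f (wirtinger_bar f)"
    unfolding weak_wirtinger_def weak_wirtinger_bar_def eq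
    using L1f L1 int by blast+
qed

section \<open>Pointwise dilatation and the charts of the sphere\<close>

text \<open>
  Beltrami's inequality at a single point, expressed by the real derivative so that it can be
  composed with holomorphic charts by the chain rule.
\<close>

definition dilatation_le :: "real \<Rightarrow> (complex \<Rightarrow> complex) \<Rightarrow> complex \<Rightarrow> bool" where
  "dilatation_le k f z \<longleftrightarrow>
     (\<exists>a b. (f has_derivative (\<lambda>w. a * w + b * cnj w)) (at z) \<and> cmod b \<le> k * cmod a)"

lemma dilatation_leD:
  assumes "dilatation_le k f z"
  shows "f differentiable at z" "cmod (wirtinger_bar f z) \<le> k * cmod (wirtinger f z)"
proof -
  obtain a b where ab: "(f has_derivative (\<lambda>w. a * w + b * cnj w)) (at z)" "cmod b \<le> k * cmod a"
    using assms unfolding dilatation_le_def by blast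
  then show "f differentiable at z" by (auto simp: differentiable_def)
  have "wirtinger f z = a" "wirtinger_bar f z = b"
    unfolding wirtinger_def wirtinger_bar_def partial_deriv_def frechet_derivative_at[OF ab(1), symmetric]
    by (simp_all add: algebra_simps)
  with ab(2) show "cmod (wirtinger_bar f z) \<le> k * cmod (wirtinger f z)" by simp
qed

text \<open>
  A holomorphic factor multiplies both coefficients of the derivative by numbers of the same
  modulus; the same holds for composition on the right.
\<close>

lemma dilatation_le_compose_left:
  assumes "dilatation_le k f z" and q: "(q has_field_derivative q') (at (f z))"
  shows "dilatation_le k (\<lambda>z. q (f z)) z"
proof -
  obtain a b where ab: "(f has_derivative (\<lambda>w. a * w + b * cnj w)) (at z)" "cmod b \<le> k * cmod a"
    using assms unfolding dilatation_le_def by blast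
  have "((\<lambda>z. q (f z)) has_derivative (\<lambda>w. q' * (a * w + b * cnj w))) (at z)"
    using has_derivative_compose[OF ab(1), of q "(*) q'"] q by (simp add: has_field_derivative_def)
  then have "((\<lambda>z. q (f z)) has_derivative (\<lambda>w. (q' * a) * w + (q' * b) * cnj w)) (at z)"
    by (simp add: algebra_simps)
  moreover have "cmod (q' * b) \<le> k * cmod (q' * a)"
    using mult_left_mono[OF ab(2), of "cmod q'"] by (simp add: norm_mult algebra_simps)
  ultimately show ?thesis unfolding dilatation_le_def by blast
qed

lemma dilatation_le_compose_right:
  assumes "dilatation_le k f (p z)" and p: "(p has_field_derivative p') (at z)"
  shows "dilatation_le k (\<lambda>z. f (p z)) z"
proof -
  obtain a b where ab: "(f has_derivative (\<lambda>w. a * w + b * cnj w)) (at (p z))" "cmod b \<le> k * cmod a"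
    using assms unfolding dilatation_le_def by blast
  have "((\<lambda>z. f (p z)) has_derivative (\<lambda>w. a * (p' * w) + b * cnj (p' * w))) (at z)"
    using has_derivative_compose[of p "(*) p'", OF _ ab(1)] p by (simp add: has_field_derivative_def)
  then have "((\<lambda>z. f (p z)) has_derivative (\<lambda>w. (a * p') * w + (b * cnj p') * cnj w)) (at z)"
    by (simp add: algebra_simps)
  moreover have "cmod (b * cnj p') \<le> k * cmod (a * p')"
    using mult_right_mono[OF ab(2), of "cmod p'"] by (simp add: norm_mult algebra_simps)
  ultimately show ?thesis unfolding dilatation_le_def by blast
qed

lemma dilatation_le_cong:
  assumes "dilatation_le k f z" "open D" "z \<in> D" "\<And>w. w \<in> D \<Longrightarrow> g w = f w"
  shows "dilatation_le k g z"
proof -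
  obtain a b where ab: "(f has_derivative (\<lambda>w. a * w + b * cnj w)) (at z)" "cmod b \<le> k * cmod a"
    using assms(1) unfolding dilatation_le_def by blast
  have "(g has_derivative (\<lambda>w. a * w + b * cnj w)) (at z)"
    by (rule has_derivative_transform_within_open[OF ab(1) assms(2,3)]) (simp add: assms(4))
  with ab(2) show ?thesis unfolding dilatation_le_def by blast
qed

lemma range_Some: "range Some = - {None}"
  by (auto simp: image_iff)

lemma inj_chart_infinity: "inj chart_infinity"
  by (auto simp: inj_def chart_infinity_def split: if_splits)

lemma chart_infinity_inverse: "w \<noteq> 0 \<Longrightarrow> chart_infinity (1 / w) = Some w"
  by (simp add: chart_infinity_def)

lemma range_chart_infinity: "range chart_infinity = - {Some 0}"
proof -
  have "x \<in> range chart_infinity" if "x \<noteq> Some 0" for x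
  proof (cases x)
    case None
    then have "x = chart_infinity 0" by (simp add: chart_infinity_def)
    then show ?thesis by blast
  next
    case (Some w)
    then have "x = chart_infinity (1 / w)" using that chart_infinity_inverse[of w] by auto
    then show ?thesis by blast
  qed
  moreover have "chart_infinity w \<noteq> Some 0" for w by (simp add: chart_infinity_def)
  ultimately show ?thesis by (metis (mono_tags) ComplI Compl_iff empty_iff imageE insert_iff rangeI subsetI subset_antisym)
qed

lemma inv_Some: "inv Some (Some w) = w"
  by (simp add: inv_f_f)

lemma inv_chart_infinity:
  "inv chart_infinity None = 0" "w \<noteq> 0 \<Longrightarrow> inv chart_infinity (Some w) = 1 / w"
  using inv_f_f[OF inj_chart_infinity, of 0] inv_f_f[OF inj_chart_infinity, of "1 / w"]
  by (simp_all add: chart_infinity_def)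

lemma local_dom_map_option:
  "local_dom (map_option f) Some Some = UNIV"
  "local_dom (map_option f) Some chart_infinity = {z. f z \<noteq> 0}"
  "local_dom (map_option f) chart_infinity Some = {z. z \<noteq> 0}"
  "local_dom (map_option f) chart_infinity chart_infinity = {z. z = 0 \<or> f (1 / z) \<noteq> 0}"
  by (auto simp: local_dom_def range_Some range_chart_infinity) (auto simp: chart_infinity_def split: if_splits)

lemma local_rep_map_option:
  "local_rep (map_option f) Some Some z = f z"
  "f z \<noteq> 0 \<Longrightarrow> local_rep (map_option f) Some chart_infinity z = 1 / f z"
  "z \<noteq> 0 \<Longrightarrow> local_rep (map_option f) chart_infinity Some z = f (1 / z)"
  "z = 0 \<or> f (1 / z) \<noteq> 0 \<Longrightarrow>
     local_rep (map_option f) chart_infinity chart_infinity z = (if z = 0 then 0 else 1 / f (1 / z))"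
  by (auto simp: local_rep_def inv_Some inv_chart_infinity chart_infinity_def)

lemma dilatation_condition_in_chart:
  assumes D: "open (local_dom F p q)"
    and rep: "\<And>z. z \<in> local_dom F p q \<Longrightarrow> local_rep F p q z = g z"
    and lip: "\<And>C. compact C \<Longrightarrow> C \<subseteq> local_dom F p q \<Longrightarrow> \<exists>L. L-lipschitz_on C g"
    and N: "negligible N" and dil: "\<And>z. z \<in> local_dom F p q - N \<Longrightarrow> dilatation_le k g z"
  shows "\<exists>g g'. weak_wirtinger (local_dom F p q) (local_rep F p q) g \<and>
        weak_wirtinger_bar (local_dom F p q) (local_rep F p q) g' \<and>
        (AE z in lebesgue_on (local_dom F p q). cmod (g' z) \<le> k * cmod (g z))"
proof -
  let ?f = "local_rep F p q" and ?D = "local_dom F p q"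
  have dil': "dilatation_le k ?f z" if "z \<in> ?D - N" for z
    using dilatation_le_cong[OF dil[OF that] D] that rep by blast
  have lip': "\<exists>L. L-lipschitz_on C ?f" if "compact C" "C \<subseteq> ?D" for C
    using lip[OF that] that(2) rep lipschitz_on_transform[of _ C g ?f] by (metis subsetD)
  have weak: "weak_wirtinger ?D ?f (wirtinger ?f)" "weak_wirtinger_bar ?D ?f (wirtinger_bar ?f)"
    using weak_wirtinger_of_locally_lipschitz[OF D lip' N dilatation_leD(1)[OF dil']] by blast+
  have "AE z in lebesgue. z \<in> ?D \<longrightarrow> cmod (wirtinger_bar ?f z) \<le> k * cmod (wirtinger ?f z)"
    using N dilatation_leD(2)[OF dil'] by (intro AE_I'[of N]) (auto simp: negligible_iff_null_sets)
  then have "AE z in lebesgue_on ?D. cmod (wirtinger_bar ?f z) \<le> k * cmod (wirtinger ?f z)"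
    using D by (subst AE_restrict_space_iff) auto
  with weak show ?thesis by blast
qed

lemma lipschitz_on_reciprocal:
  fixes f :: "complex \<Rightarrow> complex"
  assumes "compact C" and L: "L-lipschitz_on C f" and nz: "\<And>z. z \<in> C \<Longrightarrow> f z \<noteq> 0"
  shows "\<exists>L'. L'-lipschitz_on C (\<lambda>z. 1 / f z)"
proof -
  have "compact (f ` C)"
    using assms(1) lipschitz_on_continuous_on[OF L] by (rule compact_continuous_image[rotated])
  moreover have "0 \<notin> f ` C" using nz by (metis imageE)
  ultimately obtain e where e: "0 < e" "\<And>w. w \<in> f ` C \<Longrightarrow> e \<le> dist 0 w"
    using separate_point_closed[OF compact_imp_closed] by metis
  have ef: "e \<le> norm (f z)" if "z \<in> C" for z
    using e(2)[of "f z"] that by simp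
  have "(L / (e * e))-lipschitz_on C (\<lambda>z. 1 / f z)"
  proof (rule lipschitz_onI)
    fix x y assume xy: "x \<in> C" "y \<in> C"
    have "norm (1 / f x - 1 / f y) = norm (f y - f x) / (norm (f x) * norm (f y))"
      using nz xy by (simp add: diff_frac_eq norm_divide norm_mult)
    also have "\<dots> \<le> (L * norm (x - y)) / (e * e)"
    proof (rule frac_le)
      show "norm (f y - f x) \<le> L * norm (x - y)"
        using lipschitz_on_normD[OF L xy] by (simp add: norm_minus_commute)
      show "0 \<le> L * norm (x - y)"
        using lipschitz_on_nonneg[OF L] by simp
      show "e * e \<le> norm (f x) * norm (f y)"
        using e(1) ef[OF xy(1)] ef[OF xy(2)] by (intro mult_mono) simp_all
    qed (use e(1) in simp)
    finally show "dist (1 / f x) (1 / f y) \<le> L / (e * e) * dist x y" by (simp add: dist_norm)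
  qed (use lipschitz_on_nonneg[OF L] e(1) in simp)
  then show ?thesis by blast
qed

text \<open>
  Linear growth of \<open>f\<close> makes \<open>1 / f (1 / z)\<close> comparable to \<open>z\<close>. Together with the upper
  Lipschitz bound this gives a Lipschitz bound across the point at infinity, which is 0 in this
  chart.
\<close>

lemma lipschitz_near_infinity:
  fixes f :: "complex \<Rightarrow> complex"
  assumes m: "0 < m" and lower: "\<And>x y. m * norm (x - y) \<le> norm (f x - f y)"
    and upper: "\<And>x y. norm (f x - f y) \<le> M * norm (x - y)" and v: "f v = 0"
    and C: "compact C" and nz: "\<And>z. z \<in> C \<Longrightarrow> z = 0 \<or> f (1 / z) \<noteq> 0"
  shows "\<exists>L. L-lipschitz_on C (\<lambda>z. if z = 0 then 0 else 1 / f (1 / z))"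
proof -
  have "compact ((\<lambda>z. 1 - v * z) ` C)"
    using C by (intro compact_continuous_image continuous_intros)
  moreover have "0 \<notin> (\<lambda>z. 1 - v * z) ` C"
  proof
    assume "0 \<in> (\<lambda>z. 1 - v * z) ` C"
    then obtain z where z: "z \<in> C" "v * z = 1" by auto
    then have "z \<noteq> 0" by auto
    moreover from this have "1 / z = v" using z(2) by (simp add: divide_eq_eq)
    ultimately show False using nz[OF z(1)] v by simp
  qed
  ultimately obtain d where d: "0 < d" "\<And>w. w \<in> (\<lambda>z. 1 - v * z) ` C \<Longrightarrow> d \<le> dist 0 w"
    using separate_point_closed[OF compact_imp_closed] by metis
  \<comment> \<open>\<open>\<bar>z * f (1 / z)\<bar> \<ge> m * \<bar>1 - v * z\<bar>\<close>, which is at least \<open>e\<close> on \<open>C\<close>.\<close>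
  define e where "e = m * d"
  have e: "0 < e" using m d by (simp add: e_def)
  have M: "0 \<le> M" using order_trans[OF norm_ge_zero upper[of 0 1]] by simp
  have big: "e / norm z \<le> norm (f (1 / z))" if "z \<in> C" "z \<noteq> 0" for z
  proof -
    have "e / norm z \<le> m * norm (1 - v * z) / norm z"
      using d(2)[of "1 - v * z"] m that by (intro divide_right_mono) (auto simp: e_def)
    also have "\<dots> = m * norm (1 / z - v)"
    proof -
      have "1 / z - v = (1 - v * z) / z" using that by (simp add: diff_divide_distrib)
      then show ?thesis by (simp add: norm_divide)
    qed
    also have "\<dots> \<le> norm (f (1 / z))" using lower[of "1 / z" v] v by simp
    finally show ?thesis .
  qed
  let ?g = "\<lambda>z. if z = 0 then 0 else 1 / f (1 / z)"
  define L where "L = max (1 / e) (M / (e * e))"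
  have g_le: "norm (?g z) \<le> norm z / e" if "z \<in> C" for z
  proof (cases "z = 0")
    case False
    then have "1 / norm (f (1 / z)) \<le> 1 / (e / norm z)"
      using big[OF that] e by (intro divide_left_mono mult_pos_pos) (auto simp: divide_le_0_iff)
    then show ?thesis using False by (simp add: norm_divide)
  qed (use e in simp)
  have "L-lipschitz_on C ?g"
  proof (rule lipschitz_onI)
    fix x y assume xy: "x \<in> C" "y \<in> C"
    show "dist (?g x) (?g y) \<le> L * dist x y"
    proof (cases "x = 0 \<or> y = 0")
      case True
      then have "dist (?g x) (?g y) \<le> (1 / e) * dist x y"
        using g_le[OF xy(1)] g_le[OF xy(2)] by (auto simp: dist_norm)
      also have "\<dots> \<le> L * dist x y" by (intro mult_right_mono) (auto simp: L_def)
      finally show ?thesis .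
    next
      case False
      have nzf: "f (1 / x) \<noteq> 0" "f (1 / y) \<noteq> 0" using nz xy False by auto
      have "norm (1 / f (1 / x) - 1 / f (1 / y)) = norm (f (1 / y) - f (1 / x)) / (norm (f (1 / x)) * norm (f (1 / y)))"
        using nzf by (simp add: diff_frac_eq norm_divide norm_mult)
      also have "\<dots> \<le> (M * norm (1 / y - 1 / x)) / ((e / norm x) * (e / norm y))"
      proof (rule frac_le)
        show "norm (f (1 / y) - f (1 / x)) \<le> M * norm (1 / y - 1 / x)" by (rule upper)
        show "0 \<le> M * norm (1 / y - 1 / x)" using M by simp
        show "0 < (e / norm x) * (e / norm y)" using e False by simp
        show "(e / norm x) * (e / norm y) \<le> norm (f (1 / x)) * norm (f (1 / y))"
          using e False big[OF xy(1)] big[OF xy(2)] by (intro mult_mono) simp_all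
      qed
      also have "\<dots> = M / (e * e) * norm (x - y)"
        using False e by (simp add: diff_frac_eq norm_divide norm_mult field_simps)
      also have "\<dots> \<le> L * norm (x - y)" by (intro mult_right_mono) (auto simp: L_def)
      finally show ?thesis using False by (simp add: dist_norm)
    qed
  qed (use e in \<open>auto simp: L_def le_max_iff_disj\<close>)
  then show ?thesis by blast
qed

lemma negligible_reciprocal_vimage:
  assumes "negligible N"
  shows "negligible (insert 0 {z :: complex. 1 / z \<in> N})"
proof -
  have "negligible ((\<lambda>z. 1 / z) ` (N - {0}))"
  proof (rule negligible_differentiable_image_negligible)
    show "negligible (N - {0})" using assms negligible_diff by blast
    have "(\<lambda>z::complex. 1 / z) differentiable at z" if "z \<noteq> 0" for z
      by (rule field_differentiable_imp_differentiable)
         (use that in \<open>auto intro!: field_differentiable_divide\<close>)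
    then show "(\<lambda>z. 1 / z) differentiable_on N - {0}"
      by (simp add: differentiable_on_def differentiable_at_withinI)
  qed simp
  moreover have "insert 0 {z :: complex. 1 / z \<in> N} \<subseteq> insert 0 ((\<lambda>z. 1 / z) ` (N - {0}))"
  proof
    fix z assume "z \<in> insert 0 {z :: complex. 1 / z \<in> N}"
    then show "z \<in> insert 0 ((\<lambda>z. 1 / z) ` (N - {0}))"
      by (cases "z = 0") (auto intro!: image_eqI[of _ _ "1 / z"])
  qed
  ultimately show ?thesis using negligible_insert negligible_subset by blast
qed

lemma dilatation_condition_all_charts:
  fixes f :: "complex \<Rightarrow> complex"
  assumes m: "0 < m" and lower: "\<And>x y. m * norm (x - y) \<le> norm (f x - f y)"
    and upper: "\<And>x y. norm (f x - f y) \<le> M * norm (x - y)" and v: "f v = 0"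
    and N: "negligible N" and dil: "\<And>z. z \<notin> N \<Longrightarrow> dilatation_le k f z"
    and pq: "p \<in> sphere_charts" "q \<in> sphere_charts"
  shows "\<exists>g g'. weak_wirtinger (local_dom (map_option f) p q) (local_rep (map_option f) p q) g \<and>
        weak_wirtinger_bar (local_dom (map_option f) p q) (local_rep (map_option f) p q) g' \<and>
        (AE z in lebesgue_on (local_dom (map_option f) p q). cmod (g' z) \<le> k * cmod (g z))"
proof -
  have M: "0 \<le> M" using order_trans[OF norm_ge_zero upper[of 0 1]] by simp
  have lip: "M-lipschitz_on A f" for A
    using upper M by (intro lipschitz_onI) (auto simp: dist_norm)
  have zero: "f z = 0 \<longleftrightarrow> z = v" for z
    using lower[of z v] v m by (auto simp: mult_le_0_iff)
  have rec: "((\<lambda>z. 1 / z) has_field_derivative - (1 / z\<^sup>2)) (at z)" if "z \<noteq> 0" for z :: complex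
    using that by (auto intro!: derivative_eq_intros simp: power2_eq_square)
  have opens: "open {z. f z \<noteq> 0}" "open {z :: complex. z \<noteq> 0}" "open {z. z = 0 \<or> f (1 / z) \<noteq> 0}"
  proof -
    have eqs: "{z. f z \<noteq> 0} = - {v}" "{z :: complex. z \<noteq> 0} = - {0}"
        "{z. z = 0 \<or> f (1 / z) \<noteq> 0} = (if v = 0 then UNIV else - {1 / v})"
      by (auto simp: zero field_simps split: if_splits)
    show "open {z. f z \<noteq> 0}" "open {z :: complex. z \<noteq> 0}" "open {z. z = 0 \<or> f (1 / z) \<noteq> 0}"
      unfolding eqs by auto
  qed
  let ?P = "\<lambda>p q. \<exists>g g'. weak_wirtinger (local_dom (map_option f) p q) (local_rep (map_option f) p q) g \<and>
        weak_wirtinger_bar (local_dom (map_option f) p q) (local_rep (map_option f) p q) g' \<and>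
        (AE z in lebesgue_on (local_dom (map_option f) p q). cmod (g' z) \<le> k * cmod (g z))"
  have P1: "?P Some Some"
    by (rule dilatation_condition_in_chart[where g = f, OF _ _ _ N])
       (use lip dil in \<open>auto simp: local_dom_map_option local_rep_map_option\<close>)
  have P2: "?P Some chart_infinity"
  proof (rule dilatation_condition_in_chart[where g = "\<lambda>z. 1 / f z", OF _ _ _ N], unfold local_dom_map_option)
    show "\<exists>L. L-lipschitz_on C (\<lambda>z. 1 / f z)" if "compact C" "C \<subseteq> {z. f z \<noteq> 0}" for C
      using lipschitz_on_reciprocal[OF that(1) lip] that by blast
    show "dilatation_le k (\<lambda>z. 1 / f z) z" if "z \<in> {z. f z \<noteq> 0} - N" for z
      using dilatation_le_compose_left[OF dil rec] that by auto
  qed (use opens in \<open>auto simp: local_rep_map_option\<close>)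
  define N' where "N' = insert 0 {z. 1 / z \<in> N}"
  have N': "negligible N'" unfolding N'_def by (rule negligible_reciprocal_vimage[OF N])
  have dil': "dilatation_le k (\<lambda>z. f (1 / z)) z" if "z \<notin> N'" for z
    by (rule dilatation_le_compose_right[OF dil rec]) (use that in \<open>auto simp: N'_def\<close>)
  have P3: "?P chart_infinity Some"
  proof (rule dilatation_condition_in_chart[where g = "\<lambda>z. f (1 / z)", OF _ _ _ N'], unfold local_dom_map_option)
    show "\<exists>L. L-lipschitz_on C (\<lambda>z. f (1 / z))" if C: "compact C" "C \<subseteq> {z. z \<noteq> 0}" for C
    proof -
      obtain L where "L-lipschitz_on C (\<lambda>z. 1 / z)"
        using lipschitz_on_reciprocal[OF C(1) lipschitz_on_id] C(2) by auto
      then show ?thesis using lipschitz_on_compose2[OF _ lip] by blast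
    qed
  qed (use opens dil' in \<open>auto simp: local_rep_map_option\<close>)
  have P4: "?P chart_infinity chart_infinity"
  proof (rule dilatation_condition_in_chart[where g = "\<lambda>z. if z = 0 then 0 else 1 / f (1 / z)", OF _ _ _ N'],
      unfold local_dom_map_option)
    show "\<exists>L. L-lipschitz_on C (\<lambda>z. if z = 0 then 0 else 1 / f (1 / z))"
      if "compact C" "C \<subseteq> {z. z = 0 \<or> f (1 / z) \<noteq> 0}" for C
      using lipschitz_near_infinity[OF m lower upper v that(1)] that(2) by blast
    show "dilatation_le k (\<lambda>z. if z = 0 then 0 else 1 / f (1 / z)) z"
      if z: "z \<in> {z. z = 0 \<or> f (1 / z) \<noteq> 0} - N'" for z
    proof (rule dilatation_le_cong[OF _ opens(2)])
      show "dilatation_le k (\<lambda>z. 1 / f (1 / z)) z"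
        by (rule dilatation_le_compose_left[OF dil' rec]) (use z in \<open>auto simp: N'_def\<close>)
    qed (use z in \<open>auto simp: N'_def\<close>)
  qed (use opens in \<open>auto simp: local_rep_map_option\<close>)
  show "?P p q"
    using pq P1 P2 P3 P4 unfolding sphere_charts_def by blast
qed

section \<open>Local degree of maps isotopic to an affine map\<close>

lemma circlepath_in_sphere: "0 < r \<Longrightarrow> circlepath z r x \<in> sphere z r"
  by (simp add: circlepath dist_norm norm_mult norm_minus_commute)

lemma winding_number_homotopy_along_circle:
  fixes H :: "real \<Rightarrow> complex \<Rightarrow> complex"
  assumes r: "0 < r" and cont: "continuous_on ({0..1} \<times> sphere z r) (\<lambda>(t, w). H t w)"
    and nz: "\<And>t w. t \<in> {0..1} \<Longrightarrow> w \<in> sphere z r \<Longrightarrow> H t w \<noteq> (0 :: complex)"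
  shows "winding_number (\<lambda>x. H 0 (circlepath z r x)) 0 = winding_number (\<lambda>x. H 1 (circlepath z r x)) 0"
proof (rule winding_number_homotopic_loops)
  have c1: "continuous_on ({0..1} \<times> {0..1}) (\<lambda>p. (fst p :: real, circlepath z r (snd p)))"
    unfolding circlepath by (intro continuous_intros)
  have c2: "(\<lambda>p. (fst p, circlepath z r (snd p))) ` ({0..1} \<times> {0..1}) \<subseteq> {0..1} \<times> sphere z r"
    using circlepath_in_sphere[OF r, of z] by auto
  have c: "continuous_on ({0..1} \<times> {0..1}) (\<lambda>p. H (fst p) (circlepath z r (snd p)))"
    using continuous_on_compose2[OF cont c1 c2] by (simp add: split_def)
  have "circlepath z r 0 = circlepath z r 1" by (simp add: circlepath)
  then show "homotopic_loops (- {0}) (\<lambda>x. H 0 (circlepath z r x)) (\<lambda>x. H 1 (circlepath z r x))"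
    unfolding homotopic_loops using c nz circlepath_in_sphere[OF r]
    by (intro exI[of _ "\<lambda>p. H (fst p) (circlepath z r (snd p))"])
       (auto simp: pathfinish_def pathstart_def)
qed

text \<open>
  First contract the argument of \<open>u\<close> to the centre of the disk, then move the non-zero number
  \<open>u z = exp a\<close> to 1. What remains is the circle itself.
\<close>

lemma winding_number_of_factored_map:
  assumes r: "0 < r" and u: "continuous_on (cball z r) u" and nz: "\<And>w. w \<in> cball z r \<Longrightarrow> u w \<noteq> 0"
  shows "winding_number (\<lambda>x. (circlepath z r x - z) * u (circlepath z r x)) 0 = 1"
proof -
  obtain a where a: "u z = exp a" using nz[of z] r exp_Ln[of "u z"] by (metis centre_in_cball less_imp_le)
  have in_ball: "z + of_real (1 - t) * (w - z) \<in> cball z r" if "t \<in> {0..1}" "w \<in> sphere z r" for t w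
  proof -
    have "norm (of_real (1 - t) * (w - z)) \<le> 1 * r"
      using that unfolding norm_mult norm_of_real
      by (intro mult_mono) (auto simp: dist_norm norm_minus_commute)
    then show ?thesis by (simp add: dist_norm)
  qed
  have zne: "w - z \<noteq> 0" if "w \<in> sphere z r" for w using that r by auto
  \<comment> \<open>The terms \<open>1 - 0\<close> and \<open>1 - 1\<close> are the two ends of the homotopies.\<close>
  have "winding_number (\<lambda>x. (circlepath z r x - z) * u (z + of_real (1 - 0) * (circlepath z r x - z))) 0
      = winding_number (\<lambda>x. (circlepath z r x - z) * u (z + of_real (1 - 1) * (circlepath z r x - z))) 0"
    by (rule winding_number_homotopy_along_circle[OF r, of z
          "\<lambda>t w. (w - z) * u (z + of_real (1 - t) * (w - z))"])
       (use zne nz in_ball in \<open>auto simp: split_def intro!: continuous_intros continuous_on_compose2[OF u]\<close>)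
  also have "\<dots> = winding_number (\<lambda>x. (circlepath z r x - z) * exp (of_real (1 - 0) * a)) 0"
    by (simp add: a)
  also have "\<dots> = winding_number (\<lambda>x. (circlepath z r x - z) * exp (of_real (1 - 1) * a)) 0"
    by (rule winding_number_homotopy_along_circle[OF r, of z "\<lambda>t w. (w - z) * exp (of_real (1 - t) * a)"])
       (use zne in \<open>auto simp: split_def intro!: continuous_intros\<close>)
  also have "\<dots> = winding_number (circlepath z r) z"
    by (simp add: winding_number_offset[of _ z])
  also have "\<dots> = 1" using r by (rule winding_number_circlepath_centre)
  finally show ?thesis by simp
qed

text \<open>
  The factorisation at time 1 says that \<open>G 1\<close> is conformal at \<open>z\<close> with divided difference
  \<open>u\<close>. Injectivity keeps the moving image of the circle away from the moving image of its
  centre.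
\<close>

lemma winding_number_of_isotopy_to_conformal:
  fixes G :: "real \<Rightarrow> complex \<Rightarrow> complex"
  assumes r: "0 < r" and cont: "continuous_on ({0..1} \<times> cball z r) (\<lambda>(t, w). G t w)"
    and inj: "\<And>t w. t \<in> {0..1} \<Longrightarrow> w \<in> cball z r \<Longrightarrow> G t w = G t z \<Longrightarrow> w = z"
    and u: "continuous_on (cball z r) u" and nz: "\<And>w. w \<in> cball z r \<Longrightarrow> u w \<noteq> 0"
    and factor: "\<And>w. w \<in> cball z r \<Longrightarrow> G 1 w - G 1 z = (w - z) * u w"
    and g: "\<And>w. w \<in> cball z r \<Longrightarrow> g w = G 0 w"
  shows "winding_number (g \<circ> circlepath z r) (g z) = 1"
proof -
  have sub: "circlepath z r x \<in> cball z r" for x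
    using circlepath_in_sphere[OF r, of z x] sphere_cball by blast
  have "winding_number (g \<circ> circlepath z r) (g z) = winding_number (\<lambda>x. G 0 (circlepath z r x) - G 0 z) 0"
    by (subst winding_number_offset) (use r g sub in \<open>simp add: o_def\<close>)
  also have "\<dots> = winding_number (\<lambda>x. G 1 (circlepath z r x) - G 1 z) 0"
  proof (rule winding_number_homotopy_along_circle[OF r, of z "\<lambda>t w. G t w - G t z"])
    have "continuous_on ({0..1} \<times> sphere z r) (\<lambda>p. G (fst p) (snd p))"
      using continuous_on_subset[OF cont Sigma_mono[OF subset_refl sphere_cball]] by (simp add: split_def)
    moreover have "continuous_on ({0..1} \<times> sphere z r) (\<lambda>p. G (fst p) z)"
    proof -
      have 1: "continuous_on ({0..1} \<times> sphere z r) (\<lambda>p. (fst p, z))"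
        by (intro continuous_intros)
      have 2: "(\<lambda>p. (fst p, z)) ` ({0..1} \<times> sphere z r) \<subseteq> {0..1} \<times> cball z r"
        using r by auto
      show ?thesis using continuous_on_compose2[OF cont 1 2] by simp
    qed
    ultimately show "continuous_on ({0..1} \<times> sphere z r) (\<lambda>(t, w). G t w - G t z)"
      unfolding split_def by (rule continuous_on_diff)
    show "G t w - G t z \<noteq> 0" if "t \<in> {0..1}" "w \<in> sphere z r" for t w
      using inj[of t w] that r by auto
  qed
  also have "\<dots> = winding_number (\<lambda>x. (circlepath z r x - z) * u (circlepath z r x)) 0"
    using factor sub by simp
  also have "\<dots> = 1" by (rule winding_number_of_factored_map[OF r u nz])
  finally show ?thesis .
qed

text \<open>
  This is the isotopy read in the charts at infinity. At \<open>w = 0\<close> the values are bounded, uniformly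
  in \<open>t\<close>, by a multiple of \<open>\<bar>w\<bar>\<close>.
\<close>

lemma continuous_reciprocal_isotopy:
  fixes A :: "real \<Rightarrow> complex \<Rightarrow> complex"
  assumes m: "0 < m" and cont: "continuous_on ({0..1} \<times> UNIV) (\<lambda>(t, w). A t w)"
    and lower: "\<And>t x y. t \<in> {0..1} \<Longrightarrow> m * norm (x - y) \<le> norm (A t x - A t y)"
    and v: "\<And>t. t \<in> {0..1} \<Longrightarrow> A t v = 0"
    and nz: "\<And>w. w \<in> C \<Longrightarrow> 1 - v * w \<noteq> 0"
  shows "continuous_on ({0..1} \<times> C) (\<lambda>(t, w). if w = 0 then 0 else 1 / A t (1 / w))"
proof -
  let ?G = "\<lambda>p. if snd p = 0 then 0 else 1 / A (fst p) (1 / snd p)"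
  let ?S = "{0..1} \<times> C" and ?S' = "{0..1} \<times> (C - {0})"
  have big: "m * norm (1 - v * w) / norm w \<le> norm (A t (1 / w))" if "t \<in> {0..1}" "w \<noteq> 0" for t w
  proof -
    have "1 / w - v = (1 - v * w) / w" using that by (simp add: diff_divide_distrib)
    then show ?thesis using lower[of t "1 / w" v] v[of t] that by (simp add: norm_divide)
  qed
  have Anz: "A t (1 / w) \<noteq> 0" if "t \<in> {0..1}" "w \<in> C - {0}" for t w
    using big[of t w] m nz[of w] that by (auto simp: divide_le_0_iff mult_le_0_iff)
  have "(?G \<longlongrightarrow> ?G p) (at p within ?S)" if p: "p \<in> ?S" for p
  proof (cases "snd p = 0")
    case False
    have 1: "continuous_on ?S' (\<lambda>p. (fst p, 1 / snd p))"
      by (intro continuous_intros) auto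
    have 2: "(\<lambda>p. (fst p, 1 / snd p)) ` ?S' \<subseteq> {0..1} \<times> UNIV" by auto
    have "continuous_on ?S' (\<lambda>p. A (fst p) (1 / snd p))"
      using continuous_on_compose2[OF cont 1 2] by simp
    then have "continuous_on ?S' (\<lambda>p. 1 / A (fst p) (1 / snd p))"
      by (intro continuous_on_divide continuous_on_const) (use Anz in auto)
    moreover have "continuous_on ?S' (\<lambda>p. 1 / A (fst p) (1 / snd p)) \<longleftrightarrow> continuous_on ?S' ?G"
      by (intro continuous_on_cong) auto
    ultimately have "continuous_on ?S' ?G" by blast
    then have "(?G \<longlongrightarrow> ?G p) (at p within ?S')"
      using p False unfolding continuous_on_def by (cases p) auto
    moreover have "at p within ?S = at p within ?S'"
    proof (rule at_within_nhd)
      show "open {p :: real \<times> complex. snd p \<noteq> 0}"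
        by (intro open_Collect_neq continuous_intros)
    qed (use False in auto)
    ultimately show ?thesis by simp
  next
    case True
    let ?h = "\<lambda>p. norm (snd p) / (m * norm (1 - v * snd p))"
    have "norm (?G q) \<le> ?h q" if q: "q \<in> ?S" for q
    proof (cases "snd q = 0")
      case False
      have q': "fst q \<in> {0..1}" "snd q \<in> C" using q by auto
      have "0 < m * norm (1 - v * snd q) / norm (snd q)"
        using m nz[OF q'(2)] False by simp
      then have "1 / norm (A (fst q) (1 / snd q)) \<le> 1 / (m * norm (1 - v * snd q) / norm (snd q))"
        using big[OF q'(1) False] by (intro divide_left_mono mult_pos_pos) auto
      then show ?thesis using False by (simp add: norm_divide)
    qed simp
    then have "\<forall>\<^sub>F q in at p within ?S. norm (?G q) \<le> ?h q"
      by (auto simp: eventually_at_filter)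
    moreover have "(?h \<longlongrightarrow> norm (snd p) / (m * norm (1 - v * snd p))) (at p within ?S)"
      using m True by (intro tendsto_intros) auto
    then have "(?h \<longlongrightarrow> 0) (at p within ?S)" using True by simp
    ultimately have "(?G \<longlongrightarrow> 0) (at p within ?S)" by (rule Lim_null_comparison)
    then show ?thesis using True by simp
  qed
  then show ?thesis unfolding continuous_on_def split_def by blast
qed

text \<open>
  All maps of the isotopy vanish exactly at \<open>v\<close>, and their sphere maps fix infinity. Therefore the
  isotopy has the same domain in each pair of charts at all times. At time 1 the map is
  affine, and \<open>u\<close> in each of the four cases is the divided difference of its expression in the charts.
\<close>

lemma orientation_preserving_of_isotopy:
  fixes A :: "real \<Rightarrow> complex \<Rightarrow> complex"
  assumes m: "0 < m" and cont: "continuous_on ({0..1} \<times> UNIV) (\<lambda>(t, w). A t w)"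
    and lower: "\<And>t x y. t \<in> {0..1} \<Longrightarrow> m * norm (x - y) \<le> norm (A t x - A t y)"
    and v: "\<And>t. t \<in> {0..1} \<Longrightarrow> A t v = 0"
    and c: "c \<noteq> 0" "\<And>w. A 1 w = c * (w - v)"
  shows "orientation_preserving (map_option (A 0))"
proof -
  have inj: "x = y" if "t \<in> {0..1}" "A t x = A t y" for t x y
    using lower[OF that(1), of x y] m that(2) by (auto simp: mult_le_0_iff)
  have zero: "A t w = 0 \<longleftrightarrow> w = v" if "t \<in> {0..1}" for t w
    using inj[OF that, of w v] v[OF that] by auto
  have cont_sub: "continuous_on ({0..1} \<times> C) (\<lambda>p. A (fst p) (f (snd p)))"
    if "continuous_on C f" for C f
  proof -
    have 1: "continuous_on ({0..1} \<times> C) (\<lambda>p. (fst p, f (snd p)))"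
      by (intro continuous_intros continuous_on_compose2[OF that]) auto
    have 2: "(\<lambda>p. (fst p, f (snd p))) ` ({0..1} \<times> C) \<subseteq> {0..1} \<times> UNIV" by auto
    show ?thesis using continuous_on_compose2[OF cont 1 2] by simp
  qed
  let ?W = "\<lambda>p q z r. winding_number (local_rep (map_option (A 0)) p q \<circ> circlepath z r)
      (local_rep (map_option (A 0)) p q z) = 1"
  have W1: "?W Some Some z r" if r: "r > 0" for z r
  proof (rule winding_number_of_isotopy_to_conformal[OF r, where G = A and u = "\<lambda>_. c"])
    show "continuous_on ({0..1} \<times> cball z r) (\<lambda>(t, w). A t w)"
      using cont_sub[OF continuous_on_id] by (simp add: split_def)
    show "w = z" if "t \<in> {0..1}" "A t w = A t z" for t w
      using that by (rule inj)
    show "A 1 w - A 1 z = (w - z) * c" for w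
      unfolding c(2) by (simp add: algebra_simps)
  qed (use c in \<open>auto simp: local_rep_map_option\<close>)
  have W2: "?W Some chart_infinity z r" if r: "r > 0" and sub: "cball z r \<subseteq> {w. A 0 w \<noteq> 0}" for z r
  proof (rule winding_number_of_isotopy_to_conformal[OF r, where G = "\<lambda>t w. 1 / A t w"
        and u = "\<lambda>w. - 1 / (c * (w - v) * (z - v))"])
    have ne: "w \<noteq> v" if "w \<in> cball z r" for w using sub that zero[of 0] by auto
    have nz: "z \<noteq> v" using ne r by auto
    show "continuous_on ({0..1} \<times> cball z r) (\<lambda>(t, w). 1 / A t w)"
      unfolding split_def using cont_sub[OF continuous_on_id, of "cball z r"]
      by (intro continuous_on_divide continuous_on_const) (use ne zero in auto)
    show "w = z" if "t \<in> {0..1}" "w \<in> cball z r" "1 / A t w = 1 / A t z" for t w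
      using that inj by auto
    show "continuous_on (cball z r) (\<lambda>w. - 1 / (c * (w - v) * (z - v)))"
      using ne nz c by (intro continuous_intros) auto
    show "- 1 / (c * (w - v) * (z - v)) \<noteq> 0" if "w \<in> cball z r" for w
      using ne[OF that] nz c by auto
    show "1 / A 1 w - 1 / A 1 z = (w - z) * (- 1 / (c * (w - v) * (z - v)))" if "w \<in> cball z r" for w
    proof -
      have "1 / (c * X) - 1 / (c * Y) = (X - Y) * (- 1 / (c * X * Y))" if "X \<noteq> 0" "Y \<noteq> 0" for X Y :: complex
        using that c(1) by (simp add: field_simps)
      from this[of "w - v" "z - v"] show ?thesis
        using ne[OF that] nz unfolding c(2) by simp
    qed
    show "local_rep (map_option (A 0)) Some chart_infinity w = 1 / A 0 w" if "w \<in> cball z r" for w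
      using sub that by (intro local_rep_map_option) auto
  qed
  have W3: "?W chart_infinity Some z r" if r: "r > 0" and sub: "cball z r \<subseteq> {w. w \<noteq> 0}" for z r
  proof (rule winding_number_of_isotopy_to_conformal[OF r, where G = "\<lambda>t w. A t (1 / w)"
        and u = "\<lambda>w. - c / (w * z)"])
    have ne: "w \<noteq> 0" if "w \<in> cball z r" for w using subsetD[OF sub that] by simp
    have nz: "z \<noteq> 0" using ne r by auto
    show "continuous_on ({0..1} \<times> cball z r) (\<lambda>(t, w). A t (1 / w))"
      unfolding split_def by (intro cont_sub continuous_intros) (use ne in auto)
    show "w = z" if "t \<in> {0..1}" "w \<in> cball z r" "A t (1 / w) = A t (1 / z)" for t w
      using inj[OF that(1,3)] by auto
    show "continuous_on (cball z r) (\<lambda>w. - c / (w * z))"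
      using ne nz by (intro continuous_intros) auto
    show "- c / (w * z) \<noteq> 0" if "w \<in> cball z r" for w
      using ne[OF that] nz c by auto
    show "A 1 (1 / w) - A 1 (1 / z) = (w - z) * (- c / (w * z))" if "w \<in> cball z r" for w
      using ne[OF that] nz c(1) unfolding c(2) by (simp add: field_simps)
    show "local_rep (map_option (A 0)) chart_infinity Some w = A 0 (1 / w)" if "w \<in> cball z r" for w
      using ne[OF that] by (rule local_rep_map_option)
  qed
  have W4: "?W chart_infinity chart_infinity z r"
    if r: "r > 0" and sub: "cball z r \<subseteq> {w. w = 0 \<or> A 0 (1 / w) \<noteq> 0}" for z r
  proof (rule winding_number_of_isotopy_to_conformal[OF r,
        where G = "\<lambda>t w. if w = 0 then 0 else 1 / A t (1 / w)"
        and u = "\<lambda>w. 1 / (c * (1 - v * w) * (1 - v * z))"])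
    have ne: "1 - v * w \<noteq> 0" if w: "w \<in> cball z r" for w
    proof
      assume "1 - v * w = 0"
      then have vw: "v * w = 1" by simp
      then have "w \<noteq> 0" by auto
      moreover from this have "1 / w = v" using vw by (simp add: divide_eq_eq)
      ultimately show False using sub w zero[of 0 v] by auto
    qed
    have nz: "1 - v * z \<noteq> 0" using ne r by auto
    have ne': "A t (1 / w) \<noteq> 0" if "t \<in> {0..1}" "w \<in> cball z r" "w \<noteq> 0" for t w
      using zero[OF that(1)] ne[OF that(2)] that(3) by auto
    show "continuous_on ({0..1} \<times> cball z r) (\<lambda>(t, w). if w = 0 then 0 else 1 / A t (1 / w))"
      by (rule continuous_reciprocal_isotopy[OF m cont lower v ne])
    show "w = z" if t: "t \<in> {0..1}" and w: "w \<in> cball z r"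
      and eq: "(if w = 0 then 0 else 1 / A t (1 / w)) = (if z = 0 then 0 else 1 / A t (1 / z))" for t w
    proof -
      have z: "z \<in> cball z r" using r by simp
      show ?thesis
        using eq ne'[OF t w] ne'[OF t z] inj[OF t, of "1 / w" "1 / z"] by (auto split: if_splits)
    qed
    show "continuous_on (cball z r) (\<lambda>w. 1 / (c * (1 - v * w) * (1 - v * z)))"
      using ne nz c by (intro continuous_intros) auto
    show "1 / (c * (1 - v * w) * (1 - v * z)) \<noteq> 0" if "w \<in> cball z r" for w
      using ne[OF that] nz c by auto
    show "(if w = 0 then 0 else 1 / A 1 (1 / w)) - (if z = 0 then 0 else 1 / A 1 (1 / z))
        = (w - z) * (1 / (c * (1 - v * w) * (1 - v * z)))" if w: "w \<in> cball z r" for w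
    proof -
      have form: "(if x = 0 then 0 else 1 / A 1 (1 / x)) = x / (c * (1 - v * x))" if "1 - v * x \<noteq> 0" for x
      proof (cases "x = 0")
        case False
        then have "c * (1 / x - v) = c * (1 - v * x) / x" by (simp add: field_simps)
        then show ?thesis using False by (simp add: c(2))
      qed simp
      have frac: "x / (c * X) - y / (c * Y) = (x - y) * (1 / (c * X * Y))"
        if "X \<noteq> 0" "Y \<noteq> 0" "x * Y - y * X = x - y" for x y X Y :: complex
      proof -
        have "x / (c * X) - y / (c * Y) = (x * Y - y * X) / (c * X * Y)"
          using that c by (simp add: field_simps)
        then show ?thesis using that by simp
      qed
      show ?thesis
        unfolding form[OF ne[OF w]] form[OF nz]
        by (rule frac[OF ne[OF w] nz]) (simp add: algebra_simps)
    qed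
    show "local_rep (map_option (A 0)) chart_infinity chart_infinity w = (if w = 0 then 0 else 1 / A 0 (1 / w))"
      if "w \<in> cball z r" for w
      using sub that by (intro local_rep_map_option) auto
  qed
  show ?thesis
    unfolding orientation_preserving_def sphere_charts_def
    using W1 W2 W3 W4 by (simp add: local_dom_map_option)
qed

section \<open>Bilipschitz maps of the plane as maps of the sphere\<close>

text \<open>
  Continuity at infinity is properness: the preimage of a compact set under \<open>f\<close> is its image
  under the continuous inverse.
\<close>

lemma continuous_map_sphere_map_option:
  assumes cont: "continuous_on UNIV f" and inv: "\<And>x. g (f x) = x" "\<And>y. f (g y) = y"
    and contg: "continuous_on UNIV g"
  shows "continuous_map riemann_sphere riemann_sphere (map_option f)"
  unfolding continuous_map_def
proof (intro conjI allI impI)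
  show "map_option f \<in> topspace riemann_sphere \<rightarrow> topspace riemann_sphere"
    by (auto simp: riemann_sphere_def split: option.splits)
next
  fix V assume V: "openin riemann_sphere V"
  let ?P = "{x \<in> topspace riemann_sphere. map_option f x \<in> V}"
  have top: "topspace riemann_sphere = UNIV"
    by (auto simp: riemann_sphere_def image_iff)
  from V consider U where "open U" "V = Some ` U"
    | C where "compact C" "V = insert None (Some ` (- C))"
    unfolding riemann_sphere_def openin_Alexandroff_compactification
    by (auto simp: Compl_eq_Diff_UNIV)
  then show "openin riemann_sphere ?P"
  proof cases
    case 1
    have "?P = Some ` (f -` U)"
    proof (rule set_eqI)
      fix x show "x \<in> ?P \<longleftrightarrow> x \<in> Some ` (f -` U)" using 1 top by (cases x) auto
    qed
    moreover have "open (f -` U)" using cont 1 by (simp add: open_vimage)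
    ultimately show ?thesis by (simp add: riemann_sphere_def)
  next
    case 2
    have "f -` C = g ` C" using inv by (auto simp: image_iff) metis
    then have "compact (f -` C)"
      using 2 contg continuous_on_subset by (metis compact_continuous_image subset_UNIV)
    moreover have "?P = insert None (Some ` (- (f -` C)))"
    proof (rule set_eqI)
      fix x show "x \<in> ?P \<longleftrightarrow> x \<in> insert None (Some ` (- (f -` C)))" using 2 top by (cases x) auto
    qed
    moreover have "openin riemann_sphere (insert None (Some ` (- (f -` C))))" if "compact (f -` C)"
      unfolding riemann_sphere_def openin_Alexandroff_compactification
      by (rule disjI2, rule exI[of _ "f -` C"])
         (use that compact_imp_closed[OF that] in \<open>simp add: Compl_eq_Diff_UNIV\<close>)
    ultimately show ?thesis by simp
  qed
qed

text \<open>
  The range is open by invariance of domain and closed by completeness, so \<open>f\<close> is onto.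
\<close>

lemma homeomorphic_map_sphere_of_bilipschitz:
  fixes f :: "complex \<Rightarrow> complex"
  assumes m: "0 < m" and lower: "\<And>x y. m * norm (x - y) \<le> norm (f x - f y)"
    and upper: "\<And>x y. norm (f x - f y) \<le> M * norm (x - y)"
  shows "homeomorphic_map riemann_sphere riemann_sphere (map_option f)" and "surj f"
proof -
  have "0 \<le> M" using order_trans[OF norm_ge_zero upper[of 0 1]] by simp
  then have "M-lipschitz_on UNIV f" using upper by (intro lipschitz_onI) (auto simp: dist_norm)
  then have cont: "continuous_on UNIV f" by (rule lipschitz_on_continuous_on)
  have inj: "inj f"
  proof (rule injI)
    fix x y assume "f x = f y"
    then show "x = y" using lower[of x y] m by (auto simp: mult_le_0_iff)
  qed
  have "open (range f)" using invariance_of_domain[OF cont open_UNIV inj] .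
  moreover have "closed (range f)"
    unfolding closed_sequential_limits
  proof (intro allI impI, elim conjE)
    fix s l assume "\<forall>n. s n \<in> range f" and s: "s \<longlonglongrightarrow> l"
    define a where "a n = inv f (s n)" for n
    have a: "s n = f (a n)" for n
      using \<open>\<forall>n. s n \<in> range f\<close> by (simp add: a_def f_inv_into_f)
    have "Cauchy a"
    proof (rule CauchyI)
      fix e :: real assume "0 < e"
      then have "0 < m * e" using m by simp
      from CauchyD[OF LIMSEQ_imp_Cauchy[OF s] this]
      obtain n0 where n0: "\<And>i j. n0 \<le> i \<Longrightarrow> n0 \<le> j \<Longrightarrow> norm (s i - s j) < m * e"
        by blast
      have "norm (a i - a j) < e" if "n0 \<le> i" "n0 \<le> j" for i j
      proof -
        have "m * norm (a i - a j) < m * e"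
          using lower[of "a i" "a j"] n0[OF that] by (simp add: a)
        then show ?thesis using m by simp
      qed
      then show "\<exists>M. \<forall>i\<ge>M. \<forall>j\<ge>M. norm (a i - a j) < e" by blast
    qed
    then obtain b where "a \<longlonglongrightarrow> b" by (metis Cauchy_convergent convergent_def)
    then have "(\<lambda>n. f (a n)) \<longlonglongrightarrow> f b"
      using cont continuous_on_tendsto_compose[of UNIV f a b] by auto
    then have "s \<longlonglongrightarrow> f b" by (simp flip: a)
    then have "l = f b" using s LIMSEQ_unique by blast
    then show "l \<in> range f" by blast
  qed
  ultimately show surj: "surj f" using clopen[of "range f"] by blast
  define g where "g = inv f"
  have gf: "g (f x) = x" and fg: "f (g y) = y" for x y
    using inj surj by (simp_all add: g_def surj_f_inv_f)
  have "(1 / m)-lipschitz_on UNIV g"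
  proof (rule lipschitz_onI)
    fix x y show "dist (g x) (g y) \<le> 1 / m * dist x y"
      using lower[of "g x" "g y"] m by (simp add: fg dist_norm field_simps)
  qed (use m in simp)
  then have contg: "continuous_on UNIV g" by (rule lipschitz_on_continuous_on)
  have "homeomorphic_maps riemann_sphere riemann_sphere (map_option f) (map_option g)"
    unfolding homeomorphic_maps_def
    using continuous_map_sphere_map_option[OF cont gf fg contg] continuous_map_sphere_map_option[OF contg fg gf cont]
    by (simp add: option.map_comp o_def gf fg option.map_ident)
  then show "homeomorphic_map riemann_sphere riemann_sphere (map_option f)"
    using homeomorphic_map_maps by blast
qed

lemma quasiconformal_map_option:
  fixes f :: "complex \<Rightarrow> complex"
  assumes k: "0 \<le> k" "k < 1" and m: "0 < m" and c: "c \<noteq> 0"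
    and upper: "\<And>z w. cmod (f z - f w) \<le> M * cmod (z - w)"
    and lower: "\<And>t z w. t \<in> {0..1} \<Longrightarrow>
       m * cmod (z - w) \<le> cmod (of_real (1 - t) * (f z - f w) + of_real t * c * (z - w))"
    and N: "negligible N" and dil: "\<And>z. z \<notin> N \<Longrightarrow> dilatation_le k f z"
  shows "quasiconformal k (map_option f)"
proof -
  have lower0: "m * cmod (z - w) \<le> cmod (f z - f w)" for z w
    using lower[of 0 z w] by simp
  have homeo: "homeomorphic_map riemann_sphere riemann_sphere (map_option f)" and "surj f"
    using homeomorphic_map_sphere_of_bilipschitz[OF m lower0 upper] by blast+
  then obtain v where v: "f v = 0" by (metis surjD)
  have "0 \<le> M" using order_trans[OF norm_ge_zero upper[of 0 1]] by simp
  then have "M-lipschitz_on UNIV f" using upper by (intro lipschitz_onI) (auto simp: dist_norm)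
  then have cont: "continuous_on UNIV f" by (rule lipschitz_on_continuous_on)
  \<comment> \<open>Since \<open>f v = 0\<close>, subtracting \<open>v\<close> in the second term keeps the zero at \<open>v\<close> for all \<open>t\<close>.\<close>
  define A where "A t w = of_real (1 - t) * f w + of_real t * c * (w - v)" for t w
  have "orientation_preserving (map_option (A 0))"
  proof (rule orientation_preserving_of_isotopy[OF m])
    show "continuous_on ({0..1} \<times> UNIV) (\<lambda>(t, w). A t w)"
      unfolding A_def split_def
      by (intro continuous_intros continuous_on_compose2[OF cont]) auto
    show "m * cmod (x - y) \<le> cmod (A t x - A t y)" if "t \<in> {0..1}" for t x y
    proof -
      have "A t x - A t y = of_real (1 - t) * (f x - f y) + of_real t * c * (x - y)"
        by (simp add: A_def algebra_simps)
      then show ?thesis using lower[OF that, of x y] by simp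
    qed
    show "A t v = 0" for t by (simp add: A_def v)
    show "A 1 w = c * (w - v)" for w by (simp add: A_def)
  qed (rule c)
  moreover have "A 0 = f" by (simp add: A_def fun_eq_iff)
  ultimately have "orientation_preserving (map_option f)" by simp
  then show ?thesis
    unfolding quasiconformal_def
    using k homeo dilatation_condition_all_charts[OF m lower0 upper v N dil] by blast
qed

section \<open>Hyperbolic geometry of a disk not containing the origin\<close>

text \<open>
  The modulus attains its extrema on the disk where the line through 0 and \<open>c\<close> meets the
  boundary circle.
\<close>

lemma Greatest_sqrt_ratio_in_cball:
  fixes c :: complex
  assumes r: "0 < r" "r < cmod c"
  shows "(GREATEST x. \<exists>w\<in>cball c r. \<exists>z\<in>cball c r. x = sqrt (cmod (w / z)))
    = sqrt ((cmod c + r) / (cmod c - r))"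
proof (rule Greatest_equality)
  let ?u = "of_real (r / cmod c) * c"
  have C: "0 < cmod c" using r by linarith
  then have c0: "c \<noteq> 0" by auto
  have u: "cmod ?u = r" using r c0 by (simp add: norm_mult norm_divide)
  have "c + ?u = of_real (1 + r / cmod c) * c" "c - ?u = of_real (1 - r / cmod c) * c"
    by (simp_all add: algebra_simps)
  moreover have "0 \<le> 1 + r / cmod c" "0 \<le> 1 - r / cmod c" using r C by simp_all
  ultimately have "cmod (c + ?u) = (1 + r / cmod c) * cmod c" "cmod (c - ?u) = (1 - r / cmod c) * cmod c"
    by (simp_all only: norm_mult norm_of_real abs_of_nonneg)
  moreover have "(1 + r / cmod c) * cmod c = cmod c + r" "(1 - r / cmod c) * cmod c = cmod c - r"
    using C by (simp_all add: field_simps)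
  ultimately have "cmod (c + ?u) = cmod c + r" "cmod (c - ?u) = cmod c - r" by simp_all
  moreover have "c + ?u \<in> cball c r" "c - ?u \<in> cball c r" using u by (simp_all add: dist_norm)
  ultimately show "\<exists>w\<in>cball c r. \<exists>z\<in>cball c r. sqrt ((cmod c + r) / (cmod c - r)) = sqrt (cmod (w / z))"
    by (intro bexI[of _ "c + ?u"] bexI[of _ "c - ?u"]) (simp_all add: norm_divide)
next
  fix y assume "\<exists>w\<in>cball c r. \<exists>z\<in>cball c r. y = sqrt (cmod (w / z))"
  then obtain w z where wz: "cmod (c - w) \<le> r" "cmod (c - z) \<le> r" "y = sqrt (cmod (w / z))"
    by (auto simp: dist_norm)
  have "cmod w \<le> cmod c + r" "cmod c - r \<le> cmod z"
    using wz norm_triangle_ineq2[of w c] norm_triangle_ineq2[of c z] by (simp_all add: norm_minus_commute)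
  then have "cmod w / cmod z \<le> (cmod c + r) / (cmod c - r)"
    using r by (intro frac_le) auto
  then show "y \<le> sqrt ((cmod c + r) / (cmod c - r))"
    using wz by (simp add: norm_divide)
qed

text \<open>
  By a scaling that sends \<open>\<tau> c\<close> to 1, the disk becomes the one with diameter from \<open>1 / K\<close> to
  \<open>K\<close>. The Cayley transform \<open>b \<mapsto> (b - 1) / (b + 1)\<close> maps this disk onto the disk of
  radius \<open>k\<close> about 0. The calculation below squares both sides and uses
  \<open>\<tau> = (1 - k\<^sup>2) / (1 + k\<^sup>2)\<close>.
\<close>

lemma apollonian_disk_bound:
  fixes b c :: complex and r K k :: real
  defines "\<tau> \<equiv> sqrt (1 - (r / cmod c)\<^sup>2)"
  assumes r: "0 < r" "r < cmod c" and K: "K = sqrt ((cmod c + r) / (cmod c - r))"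
    and k: "k = (K - 1) / (K + 1)" and b: "cmod (b - c) \<le> r"
  shows "cmod (of_real \<tau> * c - b) \<le> k * cmod (of_real \<tau> * c + b)"
proof -
  define \<rho> where "\<rho> = r / cmod c"
  have C: "0 < cmod c" using r by linarith
  then have \<rho>: "0 < \<rho>" "\<rho> < 1" using r by (simp_all add: \<rho>_def)
  have K1: "1 \<le> K" unfolding K using r by (simp add: le_divide_eq)
  have k0: "0 \<le> k" using K1 by (simp add: k)
  have K\<rho>: "K = sqrt ((1 + \<rho>) / (1 - \<rho>))"
    unfolding K \<rho>_def using r C by (intro arg_cong[of _ _ sqrt]) (simp add: field_simps)
  have \<tau>2: "\<tau>\<^sup>2 = 1 - \<rho>\<^sup>2" and \<tau>0: "0 \<le> \<tau>"
    using \<rho> by (simp_all add: \<tau>_def \<rho>_def[symmetric] power_le_one)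
  have K2: "K\<^sup>2 * (1 - \<rho>) = 1 + \<rho>" using \<rho> by (simp add: K\<rho>)
  have \<tau>K: "\<tau> = K * (1 - \<rho>)"
  proof (rule power2_eq_imp_eq)
    have "(K * (1 - \<rho>))\<^sup>2 = (K\<^sup>2 * (1 - \<rho>)) * (1 - \<rho>)" by (simp add: power2_eq_square)
    also have "\<dots> = \<tau>\<^sup>2" unfolding K2 \<tau>2 by (simp add: power2_eq_square algebra_simps)
    finally show "\<tau>\<^sup>2 = (K * (1 - \<rho>))\<^sup>2" ..
  qed (use \<tau>0 K1 \<rho> in auto)
  have k2: "1 - k\<^sup>2 = \<tau> * (1 + k\<^sup>2)"
  proof -
    have "K * (1 - \<rho>) * (K\<^sup>2 + 1) = K * (K\<^sup>2 * (1 - \<rho>) + (1 - \<rho>))" by (simp add: algebra_simps)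
    then have *: "\<tau> * (K\<^sup>2 + 1) = 2 * K" by (simp add: K2 \<tau>K)
    have "(K + 1) * k = K - 1" using K1 by (simp add: k)
    then have hk: "(K + 1)\<^sup>2 * k\<^sup>2 = (K - 1)\<^sup>2" by (metis power_mult_distrib)
    have "(K + 1)\<^sup>2 * (1 - k\<^sup>2) = (K + 1)\<^sup>2 - (K + 1)\<^sup>2 * k\<^sup>2"
      by (simp add: algebra_simps)
    also have "\<dots> = 2 * (2 * K)" unfolding hk by (simp add: power2_eq_square algebra_simps)
    also have "\<dots> = \<tau> * ((K + 1)\<^sup>2 + (K - 1)\<^sup>2)"
      unfolding *[symmetric] by (simp add: power2_eq_square algebra_simps)
    also have "\<dots> = (K + 1)\<^sup>2 * (\<tau> * (1 + k\<^sup>2))"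
      unfolding hk[symmetric] by (simp add: algebra_simps)
    finally show ?thesis using K1 by simp
  qed
  \<comment> \<open>With \<open>s = -1\<close>, \<open>s = - \<tau>\<close> and \<open>s = \<tau>\<close> the identity \<open>sq\<close> expresses the three moduli that
      occur through \<open>X\<close>.\<close>
  define X where "X = Re (cnj c * b)"
  have sq: "(cmod (of_real s * c + b))\<^sup>2 = s\<^sup>2 * (cmod c)\<^sup>2 + (cmod b)\<^sup>2 + 2 * s * X" for s
    unfolding cmod_power2 X_def by (simp add: power2_eq_square algebra_simps)
  have "(cmod (of_real (-1) * c + b))\<^sup>2 \<le> r\<^sup>2"
    using b r by (intro power_mono) auto
  then have "(cmod c)\<^sup>2 + (cmod b)\<^sup>2 - 2 * X \<le> r\<^sup>2" unfolding sq by simp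
  moreover have "\<tau>\<^sup>2 * (cmod c)\<^sup>2 = (cmod c)\<^sup>2 - r\<^sup>2"
    using C by (simp add: \<tau>2 \<rho>_def power_divide algebra_simps)
  ultimately have disk: "\<tau>\<^sup>2 * (cmod c)\<^sup>2 + (cmod b)\<^sup>2 \<le> 2 * X" by linarith
  have "(1 - k\<^sup>2) * (\<tau>\<^sup>2 * (cmod c)\<^sup>2 + (cmod b)\<^sup>2) \<le> \<tau> * (1 + k\<^sup>2) * (2 * X)"
    unfolding k2 using disk \<tau>0 by (intro mult_left_mono) auto
  then have "\<tau>\<^sup>2 * (cmod c)\<^sup>2 + (cmod b)\<^sup>2 - 2 * \<tau> * X \<le> k\<^sup>2 * (\<tau>\<^sup>2 * (cmod c)\<^sup>2 + (cmod b)\<^sup>2 + 2 * \<tau> * X)"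
    by (simp add: algebra_simps)
  moreover have "cmod (of_real \<tau> * c - b) = cmod (of_real (- \<tau>) * c + b)"
    by (simp add: norm_minus_commute)
  ultimately have "(cmod (of_real \<tau> * c - b))\<^sup>2 \<le> (k * cmod (of_real \<tau> * c + b))\<^sup>2"
    by (simp only: sq power_mult_distrib) simp
  then show ?thesis by (rule power2_le_imp_le) (use k0 in simp)
qed

text \<open>
  After division by \<open>b\<close> the vector becomes \<open>a + q s\<close> with \<open>q = \<tau> c / b\<close>. The numbers \<open>q\<close>
  stay in a compact part of the open right half-plane, so \<open>Re (a + q s)\<close> controls \<open>s\<close>, and
  \<open>s\<close> controls the difference between \<open>a + q s\<close> and \<open>a + s\<close>.
\<close>

lemma uniform_lower_bound:
  fixes c :: complex and r \<tau> :: real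
  assumes r: "0 < r" "r < cmod c" and \<tau>: "0 < \<tau>"
  obtains m where "0 < m"
    "\<And>a b s. cmod (b - c) \<le> r \<Longrightarrow> 0 \<le> Re a \<Longrightarrow> 0 \<le> s \<Longrightarrow>
       m * cmod (a + of_real s) \<le> cmod (b * a + of_real \<tau> * c * of_real s)"
proof -
  \<comment> \<open>\<open>\<mu>\<close> bounds \<open>\<bar>b\<bar>\<close> from below, \<open>e\<close> bounds \<open>Re q\<close> from below, and \<open>Q\<close> bounds \<open>\<bar>1 - q\<bar>\<close>
      from above, where \<open>q = \<tau> c / b\<close>.\<close>
  define \<mu> where "\<mu> = cmod c - r"
  define e where "e = min 1 (\<tau> * ((cmod c)\<^sup>2 - r * cmod c) / (cmod c + r)\<^sup>2)"
  define Q where "Q = 1 + \<tau> * cmod c / \<mu>"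
  define m where "m = \<mu> / (1 + Q / e)"
  have \<mu>: "0 < \<mu>" using r by (simp add: \<mu>_def)
  have C: "0 < cmod c" using r by linarith
  have "0 < cmod c * (cmod c - r)" using C r by (intro mult_pos_pos) simp_all
  then have pos: "0 < (cmod c)\<^sup>2 - r * cmod c" by (simp add: power2_eq_square algebra_simps)
  then have e: "0 < e" "e \<le> 1" using r \<tau> by (auto simp: e_def intro!: divide_pos_pos mult_pos_pos)
  have Q: "0 < Q" using \<mu> \<tau> by (auto simp: Q_def intro!: add_pos_nonneg)
  have m: "0 < m" using \<mu> Q e by (auto simp: m_def intro!: divide_pos_pos add_pos_pos)
  show ?thesis
  proof (rule that[OF m])
    fix a b :: complex and s :: real
    assume b: "cmod (b - c) \<le> r" and a: "0 \<le> Re a" and s: "0 \<le> s"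
    have bl: "\<mu> \<le> cmod b" and bu: "cmod b \<le> cmod c + r"
      using b norm_triangle_ineq2[of c b] norm_triangle_ineq2[of b c] by (auto simp: \<mu>_def norm_minus_commute)
    then have b0: "b \<noteq> 0" "0 < cmod b" using \<mu> by auto
    define q where "q = of_real \<tau> * c / b"
    have "\<bar>Re (c * cnj (b - c))\<bar> \<le> cmod c * r"
      using abs_Re_le_cmod[of "c * cnj (b - c)"] mult_left_mono[OF b norm_ge_zero[of c]]
      unfolding norm_mult complex_mod_cnj by (rule order_trans)
    moreover have "Re (c * cnj b) = (cmod c)\<^sup>2 + Re (c * cnj (b - c))"
      unfolding cmod_power2 by (simp add: power2_eq_square algebra_simps)
    ultimately have Rcb: "(cmod c)\<^sup>2 - r * cmod c \<le> Re (c * cnj b)"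
      by (simp add: abs_le_iff mult.commute)
    have "0 < cmod c + r" using C r by simp
    then have bb: "0 < (cmod c + r)\<^sup>2 * (cmod b)\<^sup>2" using b0 by simp
    have "q = of_real (\<tau> / (cmod b)\<^sup>2) * (c * cnj b)"
      using b0 complex_norm_square[of b] by (simp add: q_def field_simps)
    then have "Re q = (\<tau> / (cmod b)\<^sup>2) * Re (c * cnj b)" by simp
    also have "\<dots> \<ge> \<tau> / (cmod c + r)\<^sup>2 * ((cmod c)\<^sup>2 - r * cmod c)"
      using Rcb bu b0 \<tau> pos bb
      by (intro mult_mono divide_left_mono power_mono) auto
    finally have eq: "e \<le> Re q" by (simp add: e_def min_le_iff_disj)
    have "cmod q = \<tau> * cmod c / cmod b" using \<tau> by (simp add: q_def norm_mult norm_divide)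
    also have "\<dots> \<le> \<tau> * cmod c / \<mu>" using bl \<mu> \<tau> by (intro divide_left_mono mult_pos_pos) auto
    finally have qQ: "cmod (1 - q) \<le> Q"
      using norm_triangle_ineq4[of 1 q] by (simp add: Q_def)
    let ?x = "a + q * of_real s"
    have "e * s \<le> Re q * s" using eq s by (rule mult_right_mono)
    also have "\<dots> \<le> Re ?x" using a by simp
    also have "\<dots> \<le> cmod ?x" by (rule complex_Re_le_cmod)
    finally have sx: "s \<le> cmod ?x / e" using e by (simp add: field_simps)
    have "a + of_real s = ?x + (1 - q) * of_real s" by (simp add: algebra_simps)
    then have "cmod (a + of_real s) \<le> cmod ?x + cmod ((1 - q) * of_real s)"
      by (metis norm_triangle_ineq)
    also have "cmod ((1 - q) * of_real s) = cmod (1 - q) * s" using s by (simp add: norm_mult)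
    also have "cmod ?x + cmod (1 - q) * s \<le> cmod ?x + Q * (cmod ?x / e)"
      using qQ sx s Q by (intro add_left_mono mult_mono) auto
    also have "\<dots> = (1 + Q / e) * cmod ?x" by (simp add: algebra_simps)
    finally have "m * cmod (a + of_real s) \<le> m * ((1 + Q / e) * cmod ?x)"
      using m by (intro mult_left_mono) auto
    also have "\<dots> = \<mu> * cmod ?x"
      using Q e by (simp add: m_def add_pos_pos less_imp_neq[THEN not_sym])
    also have "\<dots> \<le> cmod b * cmod ?x" using bl by (intro mult_right_mono) auto
    also have "\<dots> = cmod (b * a + of_real \<tau> * c * of_real s)"
      using b0 by (simp add: norm_mult[symmetric] q_def algebra_simps)
    finally show "m * cmod (a + of_real s) \<le> cmod (b * a + of_real \<tau> * c * of_real s)" .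
  qed
qed

section \<open>The extension\<close>

text \<open>
  On a convex set the bound \<open>\<bar>h' - c\<bar> \<le> r\<close> says that \<open>h - c * id\<close> is \<open>r\<close>-Lipschitz. In
  this form the hypothesis survives the passage to the closure, where \<open>h\<close> need not be
  differentiable.
\<close>

lemma boundary_extension:
  assumes hol: "h holomorphic_on right_half_plane" and r: "0 \<le> r"
    and der: "deriv h ` right_half_plane \<subseteq> cball c r"
  obtains H where "\<And>z. z \<in> right_half_plane \<Longrightarrow> H z = h z"
    "\<And>z w. 0 \<le> Re z \<Longrightarrow> 0 \<le> Re w \<Longrightarrow> cmod (H z - H w - c * (z - w)) \<le> r * cmod (z - w)"
proof -
  have op: "open right_half_plane"
    unfolding right_half_plane_def by (rule open_halfspace_Re_gt)
  have conv: "convex right_half_plane"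
    unfolding right_half_plane_def by (rule convex_halfspace_Re_gt)
  have clos: "closure right_half_plane = {z. 0 \<le> Re z}"
    using closure_halfspace_gt[of "1 :: complex" 0] by (simp add: right_half_plane_def inner_complex_def)
  define g where "g z = h z - c * z" for z
  have dg: "(g has_field_derivative (deriv h z - c)) (at z within right_half_plane)" if "z \<in> right_half_plane" for z
  proof -
    have "(h has_field_derivative deriv h z) (at z)" using hol op that by (rule holomorphic_derivI)
    then have "(g has_field_derivative (deriv h z - c)) (at z)"
      unfolding g_def by (auto intro!: derivative_eq_intros)
    then show ?thesis by (rule has_field_derivative_at_within)
  qed
  have "r-lipschitz_on right_half_plane g"
  proof (rule lipschitz_onI[OF _ r])
    fix x y assume xy: "x \<in> right_half_plane" "y \<in> right_half_plane"
    have bd: "cmod (deriv h z - c) \<le> r" if "z \<in> right_half_plane" for z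
      using der that by (auto simp: dist_norm norm_minus_commute)
    show "dist (g x) (g y) \<le> r * dist x y"
      using field_differentiable_bound[OF conv dg bd xy] by (simp add: dist_norm)
  qed
  from lipschitz_extend_closure[OF this]
  obtain G where G: "r-lipschitz_on {z. 0 \<le> Re z} G" "\<And>z. z \<in> right_half_plane \<Longrightarrow> G z = g z"
    unfolding clos by blast
  show ?thesis
  proof (rule that[of "\<lambda>z. G z + c * z"])
    show "G z + c * z = h z" if "z \<in> right_half_plane" for z
      using G(2)[OF that] by (simp add: g_def)
    show "cmod (G z + c * z - (G w + c * w) - c * (z - w)) \<le> r * cmod (z - w)"
      if "0 \<le> Re z" "0 \<le> Re w" for z w
      using lipschitz_on_normD[OF G(1), of z w] that by (simp add: algebra_simps)
  qed
qed

text \<open>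
  A point of the left half-plane is moved to its projection on the imaginary axis, and its
  real part then contributes a multiple of \<open>d\<close>; writing the projection with \<open>max\<close> and \<open>min\<close>
  gives one formula for the whole plane.
\<close>

definition shear_extension :: "(complex \<Rightarrow> complex) \<Rightarrow> complex \<Rightarrow> complex \<Rightarrow> complex" where
  "shear_extension H d z = H (Complex (max (Re z) 0) (Im z)) + d * of_real (min (Re z) 0)"

text \<open>
  Here \<open>a\<close> is the increment of the projected points and \<open>s\<close> that of the negative parts of the
  real parts. The divided difference of \<open>H\<close> lies in the disk about \<open>c\<close>, and so does its
  convex combination with \<open>d\<close>.
\<close>

lemma shear_extension_difference:
  assumes near: "\<And>z w. 0 \<le> Re z \<Longrightarrow> 0 \<le> Re w \<Longrightarrow> cmod (H z - H w - c * (z - w)) \<le> r * cmod (z - w)"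
    and d: "cmod (d - c) \<le> r" and t: "t \<in> {0..1}" and le: "Re w \<le> Re z"
  obtains a b s where "cmod (b - c) \<le> r" "0 \<le> Re a" "0 \<le> s" "z - w = a + of_real s"
    "of_real (1 - t) * (shear_extension H d z - shear_extension H d w) + of_real t * d * (z - w)
      = b * a + d * of_real s"
proof -
  define pr where "pr x = Complex (max (Re x) 0) (Im x)" for x
  define a where "a = pr z - pr w"
  define s where "s = min (Re z) 0 - min (Re w) 0"
  \<comment> \<open>For \<open>a = 0\<close> any point of the disk may serve as the divided difference.\<close>
  define b where "b = (if a = 0 then c else (H (pr z) - H (pr w)) / a)"
  define b' where "b' = of_real (1 - t) * b + of_real t * d"
  have r0: "0 \<le> r" using order_trans[OF norm_ge_zero d] .
  have Ha: "H (pr z) - H (pr w) = b * a"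
    by (auto simp: b_def a_def)
  have bc: "cmod (b - c) \<le> r"
  proof (cases "a = 0")
    case False
    have "b - c = (H (pr z) - H (pr w) - c * a) / a"
      using False by (simp add: b_def diff_divide_distrib)
    then have "cmod (b - c) = cmod (H (pr z) - H (pr w) - c * a) / cmod a"
      by (simp add: norm_divide)
    also have "\<dots> \<le> (r * cmod a) / cmod a"
      using near[of "pr z" "pr w"] by (intro divide_right_mono) (auto simp: pr_def a_def)
    finally show ?thesis using False by simp
  qed (use r0 in \<open>simp add: b_def\<close>)
  have "b' - c = of_real (1 - t) * (b - c) + of_real t * (d - c)"
    by (simp add: b'_def algebra_simps)
  then have "cmod (b' - c) \<le> (1 - t) * cmod (b - c) + t * cmod (d - c)"
    using norm_triangle_ineq[of "of_real (1 - t) * (b - c)" "of_real t * (d - c)"] t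
    by (simp only: norm_mult norm_of_real) simp
  also have "\<dots> \<le> (1 - t) * r + t * r"
    using bc d t by (intro add_mono mult_left_mono) auto
  finally have b'c: "cmod (b' - c) \<le> r" by (simp add: algebra_simps)
  have zw: "z - w = a + of_real s"
    by (simp add: complex_eq_iff a_def s_def pr_def max_def min_def)
  show ?thesis
  proof (rule that[OF b'c _ _ zw])
    show "0 \<le> Re a" "0 \<le> s" using le by (auto simp: a_def s_def pr_def)
    have "shear_extension H d z - shear_extension H d w = b * a + d * of_real s"
      using Ha by (simp add: shear_extension_def pr_def s_def algebra_simps)
    then show "of_real (1 - t) * (shear_extension H d z - shear_extension H d w) + of_real t * d * (z - w)
      = b' * a + d * of_real s"
      by (simp add: zw b'_def algebra_simps)
  qed
qed

text \<open>
  The lower bound is uniform in \<open>t\<close>; at \<open>t = 0\<close> it is the lower Lipschitz bound for \<open>f\<close> itself.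
\<close>

lemma shear_extension_bilipschitz:
  assumes r: "0 < r" "r < cmod c" and \<tau>: "0 < \<tau>" "cmod (of_real \<tau> * c - c) \<le> r"
    and near: "\<And>z w. 0 \<le> Re z \<Longrightarrow> 0 \<le> Re w \<Longrightarrow> cmod (H z - H w - c * (z - w)) \<le> r * cmod (z - w)"
  defines "f \<equiv> shear_extension H (of_real \<tau> * c)"
  obtains m M where "0 < m" "\<And>z w. cmod (f z - f w) \<le> M * cmod (z - w)"
    "\<And>t z w. t \<in> {0..1} \<Longrightarrow>
       m * cmod (z - w) \<le> cmod (of_real (1 - t) * (f z - f w) + of_real t * (of_real \<tau> * c) * (z - w))"
proof -
  let ?d = "of_real \<tau> * c :: complex"
  let ?D = "\<lambda>t z w. of_real (1 - t) * (f z - f w) + of_real t * ?d * (z - w)"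
  obtain m where m: "0 < m" "\<And>a b s. cmod (b - c) \<le> r \<Longrightarrow> 0 \<le> Re a \<Longrightarrow> 0 \<le> s \<Longrightarrow>
       m * cmod (a + of_real s) \<le> cmod (b * a + ?d * of_real s)"
    using uniform_lower_bound[OF r \<tau>(1)] by blast
  define M where "M = cmod c + r + cmod ?d"
  have D_sym: "cmod (?D t z w) = cmod (?D t w z)" for t z w
    by (subst norm_minus_cancel[symmetric]) (simp add: algebra_simps)
  have half: "m * cmod (z - w) \<le> cmod (?D t z w) \<and> cmod (?D t z w) \<le> M * cmod (z - w)"
    if t: "t \<in> {0..1}" and le: "Re w \<le> Re z" for t z w
  proof -
    obtain a b s where abs: "cmod (b - c) \<le> r" "0 \<le> Re a" "0 \<le> s" "z - w = a + of_real s"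
        "?D t z w = b * a + ?d * of_real s"
      using shear_extension_difference[OF near \<tau>(2) t le] unfolding f_def by blast
    have "s \<le> cmod (a + of_real s)"
      using complex_Re_le_cmod[of "a + of_real s"] abs(2) by simp
    moreover have "cmod a \<le> cmod (a + of_real s)"
      using abs(2,3) by (auto simp: cmod_def intro!: power_mono)
    moreover have "cmod b \<le> cmod c + r"
      using abs(1) norm_triangle_ineq2[of b c] by simp
    ultimately have "cmod b * cmod a + cmod ?d * s
        \<le> (cmod c + r) * cmod (a + of_real s) + cmod ?d * cmod (a + of_real s)"
      using r abs(3) by (intro add_mono mult_mono) auto
    moreover have "cmod (b * a + ?d * of_real s) \<le> cmod b * cmod a + cmod ?d * s"
      using norm_triangle_ineq[of "b * a" "?d * of_real s"] abs(3) by (simp add: norm_mult)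
    ultimately have "cmod (b * a + ?d * of_real s) \<le> M * cmod (a + of_real s)"
      by (simp add: M_def algebra_simps)
    then show ?thesis using m(2)[OF abs(1-3)] unfolding abs(5) unfolding abs(4) by blast
  qed
  have both: "m * cmod (z - w) \<le> cmod (?D t z w) \<and> cmod (?D t z w) \<le> M * cmod (z - w)"
    if t: "t \<in> {0..1}" for t z w
    using half[OF t, of w z] half[OF t, of z w] D_sym[of t z w] norm_minus_commute[of z w]
    by (cases "Re w \<le> Re z") auto
  show ?thesis
    by (rule that[of m M]) (use m both both[of 0] in auto)
qed

lemma shear_extension_dilatation_right:
  assumes ext: "\<And>z. z \<in> right_half_plane \<Longrightarrow> H z = h z" and hol: "h holomorphic_on right_half_plane"
    and z: "0 < Re z" and k: "0 \<le> k"
  shows "dilatation_le k (shear_extension H d) z"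
proof (rule dilatation_le_cong[of _ h _ right_half_plane])
  have op: "open right_half_plane"
    unfolding right_half_plane_def by (rule open_halfspace_Re_gt)
  then show "open right_half_plane" .
  show zH: "z \<in> right_half_plane" using z by (simp add: right_half_plane_def)
  have "(h has_field_derivative deriv h z) (at z)" using hol op zH by (rule holomorphic_derivI)
  then have "(h has_derivative (\<lambda>w. deriv h z * w + 0 * cnj w)) (at z)"
    by (simp add: has_field_derivative_def)
  then show "dilatation_le k h z"
    unfolding dilatation_le_def using k by (intro exI[of _ "deriv h z"] exI[of _ 0]) simp
  show "shear_extension H d w = h w" if "w \<in> right_half_plane" for w
    using that ext[OF that] by (simp add: shear_extension_def right_half_plane_def max_def min_def)
qed

text \<open>
  The derivative of \<open>y \<mapsto> H (\<i> y)\<close> is \<open>\<i> b\<close> with \<open>b\<close> in the disk about \<open>c\<close>, since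
  it is a limit of difference quotients.
\<close>

lemma shear_extension_dilatation_left:
  assumes near: "\<And>z w. 0 \<le> Re z \<Longrightarrow> 0 \<le> Re w \<Longrightarrow> cmod (H z - H w - c * (z - w)) \<le> r * cmod (z - w)"
    and z: "Re z < 0" and diff: "(\<lambda>y. H (\<i> * of_real y)) differentiable at (Im z)"
    and k: "\<And>b. cmod (b - c) \<le> r \<Longrightarrow> cmod (d - b) \<le> k * cmod (d + b)"
  shows "dilatation_le k (shear_extension H d) z"
proof -
  define \<phi> where "\<phi> y = H (\<i> * of_real y)" for y
  obtain e where e: "(\<phi> has_vector_derivative e) (at (Im z))"
    using diff by (auto simp: \<phi>_def[abs_def] vector_derivative_works)
  define b where "b = - \<i> * e"
  have e': "e = \<i> * b" by (simp add: b_def)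
  have der_Im: "((\<lambda>w. \<phi> (Im w)) has_derivative (\<lambda>w. Im w *\<^sub>R e)) (at z)"
    using has_derivative_compose[OF bounded_linear_imp_has_derivative[OF bounded_linear_Im]
        e[unfolded has_vector_derivative_def]] .
  have bc: "cmod (b - c) \<le> r"
  proof -
    \<comment> \<open>The partial derivative of \<open>u\<close> in the direction \<open>\<i>\<close> is \<open>e - \<i> c\<close>, and its vertical
        difference quotients are bounded by \<open>r\<close>.\<close>
    define u where "u w = \<phi> (Im w) - \<i> * c * of_real (Im w)" for w
    have "((\<lambda>w. of_real (Im w) :: complex) has_derivative (\<lambda>w. of_real (Im w))) (at z)"
      by (intro bounded_linear_imp_has_derivative bounded_linear_compose[OF bounded_linear_of_real bounded_linear_Im])
    then have u: "(u has_derivative (\<lambda>w. Im w *\<^sub>R e - \<i> * c * of_real (Im w))) (at z)"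
      unfolding u_def by (intro has_derivative_diff der_Im has_derivative_mult_right)
    then have "u differentiable at z" by (auto simp: differentiable_def)
    from difference_quotients_tendsto_partial_deriv[OF this, of \<i>]
    have "(\<lambda>n. of_nat (Suc n) * (u (z + \<i> / of_nat (Suc n)) - u z)) \<longlonglongrightarrow> e - \<i> * c"
      by (simp add: partial_deriv_def frechet_derivative_at[OF u, symmetric])
    moreover have "norm (of_nat (Suc n) * (u (z + \<i> / of_nat (Suc n)) - u z)) \<le> r" for n
    proof -
      define p where "p = \<i> * complex_of_real (Im z)"
      define q where "q = \<i> * complex_of_real (Im z + 1 / real (Suc n))"
      have Imq: "Im (z + \<i> / of_nat (Suc n)) = Im z + 1 / real (Suc n)"
      proof -
        have "\<i> / of_nat (Suc n) = \<i> * complex_of_real (1 / real (Suc n))" by simp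
        then show ?thesis by (simp only: plus_complex.simps) simp
      qed
      have qp: "q - p = \<i> * complex_of_real (1 / real (Suc n))"
        by (simp add: p_def q_def distrib_left)
      have "u (z + \<i> / of_nat (Suc n)) - u z = H q - H p - c * (q - p)"
        unfolding u_def Imq \<phi>_def p_def q_def by (simp add: algebra_simps)
      also have "cmod \<dots> \<le> r * cmod (q - p)" by (rule near) (simp_all add: p_def q_def)
      also have "cmod (q - p) = 1 / real (Suc n)" unfolding qp norm_mult norm_of_real by simp
      finally have "real (Suc n) * norm (u (z + \<i> / of_nat (Suc n)) - u z) \<le> real (Suc n) * (r * (1 / real (Suc n)))"
        by (intro mult_left_mono) auto
      then show ?thesis by (simp add: norm_mult del: of_nat_Suc)
    qed
    ultimately have "cmod (e - \<i> * c) \<le> r" by (intro Lim_norm_ubound) auto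
    moreover have "e - \<i> * c = \<i> * (b - c)" by (simp add: e' algebra_simps)
    ultimately show ?thesis by (simp add: norm_mult)
  qed
  have "((\<lambda>w. \<phi> (Im w) + d * of_real (Re w)) has_derivative (\<lambda>w. Im w *\<^sub>R e + d * of_real (Re w))) (at z)"
  proof -
    have "((\<lambda>w. of_real (Re w) :: complex) has_derivative (\<lambda>w. of_real (Re w))) (at z)"
      by (intro bounded_linear_imp_has_derivative bounded_linear_compose[OF bounded_linear_of_real bounded_linear_Re])
    then show ?thesis by (intro has_derivative_add der_Im has_derivative_mult_right)
  qed
  moreover have "(\<lambda>w. Im w *\<^sub>R e + d * of_real (Re w)) = (\<lambda>w. ((d + b) / 2) * w + ((d - b) / 2) * cnj w)"
  proof
    fix w :: complex
    have "((d + b) / 2) * w + ((d - b) / 2) * cnj w = d * ((w + cnj w) / 2) + b * ((w - cnj w) / 2)"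
      by (simp add: field_simps)
    also have "\<dots> = d * of_real (Re w) + b * (\<i> * of_real (Im w))"
      by (simp add: complex_add_cnj complex_diff_cnj)
    finally show "Im w *\<^sub>R e + d * of_real (Re w) = ((d + b) / 2) * w + ((d - b) / 2) * cnj w"
      by (simp add: e' scaleR_conv_of_real algebra_simps)
  qed
  ultimately have "((\<lambda>w. \<phi> (Im w) + d * of_real (Re w)) has_derivative
      (\<lambda>w. ((d + b) / 2) * w + ((d - b) / 2) * cnj w)) (at z)" by simp
  moreover have "cmod ((d - b) / 2) \<le> k * cmod ((d + b) / 2)"
    using k[OF bc] by (simp add: norm_divide)
  ultimately have dil: "dilatation_le k (\<lambda>w. \<phi> (Im w) + d * of_real (Re w)) z"
    unfolding dilatation_le_def by blast
  show ?thesis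
  proof (rule dilatation_le_cong[OF dil open_halfspace_Re_lt])
    show "z \<in> {w. Re w < 0}" using z by simp
    show "shear_extension H d w = \<phi> (Im w) + d * of_real (Re w)" if "w \<in> {w. Re w < 0}" for w
    proof -
      have "Complex 0 (Im w) = \<i> * of_real (Im w)" by (simp add: complex_eq_iff)
      then show ?thesis using that by (simp add: shear_extension_def \<phi>_def max_def min_def)
    qed
  qed
qed

theorem theorem5p6:
  fixes h :: "complex \<Rightarrow> complex" and B :: "complex set" and c :: complex and r K k :: real
  assumes "h holomorphic_on right_half_plane"
    and "B = cball c r" and "r > 0"
    and "0 \<notin> B"
    and "deriv h ` right_half_plane \<subseteq> B"
    and "K = (GREATEST x. \<exists>w\<in>B. \<exists>z\<in>B. x = sqrt (cmod (w / z)))"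
    and "k = (K - 1) / (K + 1)"
  shows "has_qc_extension_fixing_infinity k h"
proof -
  have r: "0 < r" "r < cmod c" using assms(2-4) by (auto simp: dist_norm)
  have K: "K = sqrt ((cmod c + r) / (cmod c - r))"
    using Greatest_sqrt_ratio_in_cball[OF r] assms(2,6) by simp
  have "1 \<le> K" unfolding K using r by (simp add: le_divide_eq)
  then have k: "0 \<le> k" "k < 1" by (simp_all add: assms(7))
  define \<rho> where "\<rho> = r / cmod c"
  define \<tau> where "\<tau> = sqrt (1 - \<rho>\<^sup>2)"
  have C: "0 < cmod c" using r by linarith
  have \<rho>: "0 < \<rho>" "\<rho> < 1" using r C by (simp_all add: \<rho>_def)
  have \<rho>2: "\<rho>\<^sup>2 \<le> \<rho>" using \<rho> by (simp add: power2_eq_square mult_le_cancel_left1)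
  have \<tau>: "0 < \<tau>" "\<tau> \<le> 1" "1 - \<rho> \<le> \<tau>"
  proof -
    have "\<rho>\<^sup>2 < 1" using \<rho>2 \<rho> by linarith
    then show "0 < \<tau>" "\<tau> \<le> 1" by (simp_all add: \<tau>_def)
    have "(1 - \<rho>)\<^sup>2 \<le> 1 - \<rho>\<^sup>2" using \<rho>2 by (simp add: power2_eq_square algebra_simps)
    then show "1 - \<rho> \<le> \<tau>" unfolding \<tau>_def by (rule real_le_rsqrt)
  qed
  \<comment> \<open>The hyperbolic centre of the disk; \<open>1 - \<rho> \<le> \<tau> \<le> 1\<close> places it in the disk.\<close>
  define d where "d = of_real \<tau> * c"
  have "d - c = of_real (\<tau> - 1) * c" by (simp add: d_def algebra_simps)
  then have "cmod (d - c) = (1 - \<tau>) * cmod c" using \<tau> by (simp only: norm_mult norm_of_real) simp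
  also have "\<dots> \<le> \<rho> * cmod c" using \<tau> by (intro mult_right_mono) auto
  also have "\<dots> = r" using C by (simp add: \<rho>_def)
  finally have dc: "cmod (of_real \<tau> * c - c) \<le> r" by (simp add: d_def)
  obtain H where H: "\<And>z. z \<in> right_half_plane \<Longrightarrow> H z = h z"
      and near: "\<And>z w. 0 \<le> Re z \<Longrightarrow> 0 \<le> Re w \<Longrightarrow> cmod (H z - H w - c * (z - w)) \<le> r * cmod (z - w)"
    using boundary_extension[of h r c] assms(1,2,3,5) by (metis less_imp_le)
  define f where "f = shear_extension H d"
  obtain m M where m: "0 < m" and upper: "\<And>z w. cmod (f z - f w) \<le> M * cmod (z - w)"
      and lower: "\<And>t z w. t \<in> {0..1} \<Longrightarrow>
       m * cmod (z - w) \<le> cmod (of_real (1 - t) * (f z - f w) + of_real t * d * (z - w))"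
    using shear_extension_bilipschitz[OF r \<tau>(1) dc near] unfolding f_def d_def by metis
  define N1 where "N1 = {y. \<not> (\<lambda>y. H (\<i> * of_real y)) differentiable at y}"
  have "(cmod c + r)-lipschitz_on UNIV (\<lambda>y. H (\<i> * of_real y))"
  proof (rule lipschitz_onI)
    fix x y :: real
    let ?x = "\<i> * complex_of_real x" and ?y = "\<i> * complex_of_real y"
    have n: "cmod (?x - ?y) = \<bar>x - y\<bar>"
      by (simp add: norm_mult flip: right_diff_distrib of_real_diff)
    have "cmod (H ?x - H ?y) \<le> cmod (H ?x - H ?y - c * (?x - ?y)) + cmod (c * (?x - ?y))"
      using norm_triangle_ineq[of "H ?x - H ?y - c * (?x - ?y)" "c * (?x - ?y)"] by simp
    also have "\<dots> \<le> r * cmod (?x - ?y) + cmod c * cmod (?x - ?y)"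
      using near[of ?x ?y] by (simp add: norm_mult)
    finally show "dist (H ?x) (H ?y) \<le> (cmod c + r) * dist x y"
      unfolding n by (simp add: dist_norm algebra_simps)
  qed (use r in simp)
  then have "negligible N1"
    unfolding N1_def by (rule negligible_nondifferentiable_lipschitz_curve)
  then have N: "negligible ({z. Re z = 0} \<union> {z. Im z \<in> N1})"
    using negligible_hyperplane[of "1 :: complex" 0]
    by (intro negligible_Un negligible_Im_vimage) (simp_all add: inner_complex_def)
  have ineq: "cmod (d - b) \<le> k * cmod (d + b)" if "cmod (b - c) \<le> r" for b
    using apollonian_disk_bound[OF r K assms(7) that] by (simp add: d_def \<tau>_def \<rho>_def)
  have dil: "dilatation_le k f z" if z: "z \<notin> {z. Re z = 0} \<union> {z. Im z \<in> N1}" for z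
  proof (cases "0 < Re z")
    case True
    then show ?thesis
      unfolding f_def using shear_extension_dilatation_right[OF H assms(1) _ k(1)] by blast
  next
    case False
    then have "Re z < 0" "(\<lambda>y. H (\<i> * of_real y)) differentiable at (Im z)"
      using z by (auto simp: N1_def)
    then show ?thesis
      unfolding f_def using shear_extension_dilatation_left[OF near _ _ ineq] by blast
  qed
  have "d \<noteq> 0" using \<tau> C by (auto simp: d_def)
  then have "quasiconformal k (map_option f)"
    by (rule quasiconformal_map_option[OF k m _ upper lower N dil])
  moreover have "map_option f (Some z) = Some (h z)" if "z \<in> right_half_plane" for z
    using that H[OF that] by (simp add: f_def shear_extension_def right_half_plane_def max_def min_def)
  ultimately show ?thesis
    unfolding has_qc_extension_fixing_infinity_def by (intro exI[of _ "map_option f"]) simp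
qed

end
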